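(* Let $R$ be a commutative noetherian semilocal ring with Jacobson radical $J$ which is $J$-adically complete. Let $\mathscr{M}$ be a $\mathcal{B}$-diagram in the category of $R$-modules such that $\mathscr{M}(\sigma)$ is finitely generated and $\mathrm{im}(\mathscr{M}(\mho_\sigma))\subseteq\ker(\mathscr{M}(\Omega_\sigma))$ for every vertex $\sigma$ of $\mathcal{B}$. If $0\neq m\in\mathscr{M}(\emptyset)$, then there exists a ray $\overline{\sigma}=(\sigma^i)$ in $\mathcal{B}$ such that exactly one of the following holds: (1) there exists $j\in\mathbb{N}$ such that $m\in\widetilde{\mu}_{\leq j}\ker(\mathscr{M}(\Omega_{\sigma^j}))\setminus\widetilde{\mu}_{\leq j}\,\mathrm{im}(\mathscr{M}(\mho_{\sigma^j}))$; (2) there exists $(m_i)\in\prod_{i\in\mathbb{N}}M[i]$ with $m_0=m$ and $(m_i,m_{i-1})\in\widetilde{\mu}_i$ for all $i>0$, but $m\notin\bigcup_{i\in\mathbb{N}}\widetilde{\mu}_{\leq i}0$.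
   Context: The quiver $\mathcal{B}$: its vertices are the finite sequences of $0$'s and $1$'s (including the empty sequence $\emptyset$, the root); for each vertex $\sigma$ there are arrows $\Omega_\sigma\colon\sigma\to\sigma1$ and $\mho_\sigma\colon\sigma0\to\sigma$, where $\sigma1,\sigma0$ denote $\sigma$ extended on the right by $1$, resp. $0$. A $\mathcal{B}$-diagram $\mathscr{M}$ in $R$-modules assigns an $R$-module to each vertex and an $R$-linear map to each arrow. A ray is a sequence $(\sigma^0,\sigma^1,\dots)$ of vertices with $\sigma^0=\emptyset$ and $\sigma^{i}$ equal to $\sigma^{i-1}$ extended by one symbol; write $\sigma_i=+$ if that symbol is $1$ and $\sigma_i=-$ if it is $0$. Given a ray, put $M[i]=\mathscr{M}(\sigma^i)$ and, for $i\geq1$, let $\mu_i$ be the image under $\mathscr{M}$ of the arrow between $\sigma^{i-1}$ and $\sigma^i$: so $\mu_i=\mathscr{M}(\mho_{\sigma^{i-1}})\colon M[i]\to M[i-1]$ if $\sigma_i=-$, and $\mu_i=\mathscr{M}(\Omega_{\sigma^{i-1}})\colon M[i-1]\to M[i]$ if $\sigma_i=+$. Define the relation $\widetilde{\mu}_i\subseteq M[i]\oplus M[i-1]$ by $\widetilde{\mu}_i=\{(x,\mu_i(x)):x\in M[i]\}$ if $\sigma_i=-$ and $\widetilde{\mu}_i=\{(\mu_i(y),y):y\in M[i-1]\}$ if $\sigma_i=+$. For $S\subseteq M[n]$, $\widetilde{\mu}_{\leq 0}S=S$ (for $n=0$) and, for $n>0$, $\widetilde{\mu}_{\leq n}S$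 is the set of $m_0\in M[0]$ for which there are $m_i\in M[i]$ ($1\le i\le n$) with $m_n\in S$ and $(m_i,m_{i-1})\in\widetilde{\mu}_i$ for $1\leq i\leq n$. Here $\widetilde{\mu}_{\leq i}0$ means $\widetilde{\mu}_{\leq i}\{0\}$. *)

theory Defs
  imports "HOL-Algebra.Ring_Divisibility" "HOL-Algebra.Ideal_Product" "HOL-Algebra.Module"
begin

definition jacobson_radical :: "('r, 'x) ring_scheme \<Rightarrow> 'r set" where
  "jacobson_radical R = carrier R \<inter> \<Inter> {I. maximalideal I R}"

definition semilocal :: "('r, 'x) ring_scheme \<Rightarrow> bool" where
  "semilocal R \<longleftrightarrow> finite {I. maximalideal I R}"

fun ideal_pow :: "('r, 'x) ring_scheme \<Rightarrow> 'r set \<Rightarrow> nat \<Rightarrow> 'r set" where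
  "ideal_pow R I 0 = carrier R"
| "ideal_pow R I (Suc n) = ideal_prod R (ideal_pow R I n) I"

text \<open>I-adic completeness: the canonical map R \<rightarrow> lim R/I^n is bijective.
  Injectivity: the intersection of all I^n is 0.  Surjectivity: every compatible
  family (r_n + I^n), i.e. r_(n+1) - r_n \<in> I^n, comes from an element of R.\<close>
definition adically_complete :: "('r, 'x) ring_scheme \<Rightarrow> 'r set \<Rightarrow> bool" where
  "adically_complete R I \<longleftrightarrow>
     (\<Inter>n. ideal_pow R I n) = {\<zero>\<^bsub>R\<^esub>} \<and>
     (\<forall>r. (\<forall>n. r n \<in> carrier R \<and> r (Suc n) \<ominus>\<^bsub>R\<^esub> r n \<in> ideal_pow R I n) \<longrightarrow>
          (\<exists>x\<in>carrier R. \<forall>n. x \<ominus>\<^bsub>R\<^esub> r n \<in> ideal_pow R I n))"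

definition module_hom :: "('r, 'x) ring_scheme \<Rightarrow> ('r, 'm) module \<Rightarrow> ('r, 'n) module
    \<Rightarrow> ('m \<Rightarrow> 'n) \<Rightarrow> bool" where
  "module_hom R A B f \<longleftrightarrow>
     f \<in> carrier A \<rightarrow> carrier B \<and>
     (\<forall>x\<in>carrier A. \<forall>y\<in>carrier A. f (x \<oplus>\<^bsub>A\<^esub> y) = f x \<oplus>\<^bsub>B\<^esub> f y) \<and>
     (\<forall>a\<in>carrier R. \<forall>x\<in>carrier A. f (a \<odot>\<^bsub>A\<^esub> x) = a \<odot>\<^bsub>B\<^esub> f x)"

definition fin_gen_module :: "('r, 'x) ring_scheme \<Rightarrow> ('r, 'm) module \<Rightarrow> bool" where
  "fin_gen_module R M \<longleftrightarrow>
     (\<exists>A. finite A \<and> A \<subseteq> carrier M \<and>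
        carrier M = {finsum M (\<lambda>a. c a \<odot>\<^bsub>M\<^esub> a) A | c. c \<in> A \<rightarrow> carrier R})"

definition hom_ker :: "('r, 'm) module \<Rightarrow> ('r, 'n) module \<Rightarrow> ('m \<Rightarrow> 'n) \<Rightarrow> 'm set" where
  "hom_ker A B f = {x \<in> carrier A. f x = \<zero>\<^bsub>B\<^esub>}"

definition hom_im :: "('r, 'm) module \<Rightarrow> ('m \<Rightarrow> 'n) \<Rightarrow> 'n set" where
  "hom_im A f = f ` carrier A"

text \<open>Vertices are finite 0/1-sequences, represented as bool lists (True = 1, False = 0);
  extending on the right by a symbol b is  \<sigma> @ [b].  A B-diagram consists of
  Md :: vertex \<Rightarrow> module, Om \<sigma> = image of \<Omega>_\<sigma> : Md \<sigma> \<rightarrow> Md (\<sigma>1),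
  Mh \<sigma> = image of \<mho>_\<sigma> : Md (\<sigma>0) \<rightarrow> Md \<sigma>.\<close>

definition B_diagram :: "('r, 'x) ring_scheme \<Rightarrow> (bool list \<Rightarrow> ('r, 'm) module)
    \<Rightarrow> (bool list \<Rightarrow> 'm \<Rightarrow> 'm) \<Rightarrow> (bool list \<Rightarrow> 'm \<Rightarrow> 'm) \<Rightarrow> bool" where
  "B_diagram R Md Om Mh \<longleftrightarrow>
     (\<forall>\<sigma>. module R (Md \<sigma>) \<and>
         module_hom R (Md \<sigma>) (Md (\<sigma> @ [True])) (Om \<sigma>) \<and>
         module_hom R (Md (\<sigma> @ [False])) (Md \<sigma>) (Mh \<sigma>))"

text \<open>A ray is determined by an infinite bool sequence s: \<sigma>^i = [s 0, ..., s (i-1)],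
  and \<sigma>_i = + iff s (i-1) = True.\<close>
definition ray_vertex :: "(nat \<Rightarrow> bool) \<Rightarrow> nat \<Rightarrow> bool list" where
  "ray_vertex s i = map s [0..<i]"

definition mu_rel :: "(bool list \<Rightarrow> ('r, 'm) module) \<Rightarrow> (bool list \<Rightarrow> 'm \<Rightarrow> 'm)
    \<Rightarrow> (bool list \<Rightarrow> 'm \<Rightarrow> 'm) \<Rightarrow> (nat \<Rightarrow> bool) \<Rightarrow> nat \<Rightarrow> ('m \<times> 'm) set" where
  "mu_rel Md Om Mh s i =
     (if s (i - 1)
      then {(Om (ray_vertex s (i - 1)) y, y) | y. y \<in> carrier (Md (ray_vertex s (i - 1)))}
      else {(x, Mh (ray_vertex s (i - 1)) x) | x. x \<in> carrier (Md (ray_vertex s i))})"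

definition mu_le :: "(bool list \<Rightarrow> ('r, 'm) module) \<Rightarrow> (bool list \<Rightarrow> 'm \<Rightarrow> 'm)
    \<Rightarrow> (bool list \<Rightarrow> 'm \<Rightarrow> 'm) \<Rightarrow> (nat \<Rightarrow> bool) \<Rightarrow> nat \<Rightarrow> 'm set \<Rightarrow> 'm set" where
  "mu_le Md Om Mh s n S =
     {m0. \<exists>m :: nat \<Rightarrow> 'm. m 0 = m0 \<and> m n \<in> S \<and>
        (\<forall>i\<le>n. m i \<in> carrier (Md (ray_vertex s i))) \<and>
        (\<forall>i\<in>{1..n}. (m i, m (i - 1)) \<in> mu_rel Md Om Mh s i)}"

end

theory Submission
  imports Defs
begin

text \<open>
  Whatever the ray, (1) and (2) exclude each other: an element of \<open>M[j]\<close> witnessing (1) is killed by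
  the next step if that step is \<open>\<Omega>\<close>, and cannot be continued if it is \<open>\<mho>\<close>. Choose the ray greedily,
  following \<open>\<mho>\<close> at \<open>\<sigma>\<^sup>i\<close> exactly when \<open>m\<close> is related to an element of the kernel of \<open>\<Omega>\<close> there. If (1)
  fails along it, then \<open>m\<close> is for every \<open>n\<close> related to some element of \<open>M[n]\<close>, but never to \<open>0\<close>. These
  finite chains are glued to an infinite one by linear compactness: in a finitely generated module
  a decreasing sequence of nonempty affine subsets has a common point.

  Linear compactness passes from \<open>R\<close> to finitely generated modules one generator at a time. For \<open>R\<close>
  itself, each \<open>R / J\<^sup>k\<close> is artinian, so a decreasing sequence of cosets becomes stationary modulo
  every \<open>J\<^sup>k\<close>; one obtains a Cauchy sequence, whose limit lies in all the cosets because ideals are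
  closed by Krull's intersection theorem.
\<close>

section \<open>Ideals of commutative rings\<close>

lemma (in cring) ideal_add_mem:
  "ideal I R \<Longrightarrow> a \<in> I \<Longrightarrow> b \<in> I \<Longrightarrow> a \<oplus> b \<in> I"
  by (simp add: additive_subgroup.a_closed ideal.axioms(1))

lemma (in cring) ideal_minus_mem:
  "ideal I R \<Longrightarrow> a \<in> I \<Longrightarrow> b \<in> I \<Longrightarrow> a \<ominus> b \<in> I"
  by (simp add: a_minus_def additive_subgroup.a_closed additive_subgroup.a_inv_closed ideal.axioms(1))

lemma (in cring) ideal_zero_mem: "ideal I R \<Longrightarrow> \<zero> \<in> I"
  by (simp add: additive_subgroup.zero_closed ideal.axioms(1))

lemma (in cring) cring_idealI:
  assumes "I \<subseteq> carrier R" "\<zero> \<in> I"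
    and add: "\<And>a b. a \<in> I \<Longrightarrow> b \<in> I \<Longrightarrow> a \<oplus> b \<in> I"
    and mult: "\<And>a r. a \<in> I \<Longrightarrow> r \<in> carrier R \<Longrightarrow> r \<otimes> a \<in> I"
  shows "ideal I R"
proof (rule idealI)
  show "subgroup I (add_monoid R)"
  proof (rule add.subgroupI)
    show "\<ominus> a \<in> I" if "a \<in> I" for a
    proof -
      have "\<ominus> a = (\<ominus> \<one>) \<otimes> a" using that assms(1) by (auto simp: l_minus)
      then show ?thesis using mult[OF that, of "\<ominus> \<one>"] by simp
    qed
  qed (use assms in auto)
  show "ring R" by (rule ring_axioms)
qed (use assms in \<open>auto simp: m_comm subset_iff\<close>)

lemma (in cring) sum_ideal_mem_iff:
  "z \<in> I <+>\<^bsub>R\<^esub> J \<longleftrightarrow> (\<exists>a\<in>I. \<exists>b\<in>J. z = a \<oplus> b)"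
  by (auto simp: set_add_def')

lemma (in cring) sum_ideal_upper:
  assumes "ideal I R" "ideal J R"
  shows "I \<subseteq> I <+>\<^bsub>R\<^esub> J" "J \<subseteq> I <+>\<^bsub>R\<^esub> J"
proof -
  have "a = a \<oplus> \<zero>" if "a \<in> I" for a using that assms ideal.Icarr by fastforce
  then show "I \<subseteq> I <+>\<^bsub>R\<^esub> J" using ideal_zero_mem[OF assms(2)] sum_ideal_mem_iff by blast
  have "b = \<zero> \<oplus> b" if "b \<in> J" for b using that assms ideal.Icarr by fastforce
  then show "J \<subseteq> I <+>\<^bsub>R\<^esub> J" using ideal_zero_mem[OF assms(1)] sum_ideal_mem_iff by blast
qed

lemma (in cring) sum_ideal_least:
  assumes "ideal X R" "I \<subseteq> X" "J \<subseteq> X"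
  shows "I <+>\<^bsub>R\<^esub> J \<subseteq> X"
proof
  fix z assume "z \<in> I <+>\<^bsub>R\<^esub> J"
  then obtain a b where "a \<in> I" "b \<in> J" "z = a \<oplus> b" unfolding sum_ideal_mem_iff by blast
  then show "z \<in> X" using assms ideal_add_mem[OF assms(1), of a b] by auto
qed

lemma (in cring) ideal_adjoin:
  assumes "ideal I R" "x \<in> carrier R"
  shows "ideal (I <+>\<^bsub>R\<^esub> PIdl x) R" "I \<subseteq> I <+>\<^bsub>R\<^esub> PIdl x" "x \<in> I <+>\<^bsub>R\<^esub> PIdl x"
    and "\<And>z. z \<in> I <+>\<^bsub>R\<^esub> PIdl x \<Longrightarrow> \<exists>a\<in>I. \<exists>r\<in>carrier R. z = a \<oplus> r \<otimes> x"
proof -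
  note p = cgenideal_ideal[OF assms(2)]
  show "ideal (I <+>\<^bsub>R\<^esub> PIdl x) R" by (rule add_ideals[OF assms(1) p])
  show "I \<subseteq> I <+>\<^bsub>R\<^esub> PIdl x" by (rule sum_ideal_upper[OF assms(1) p])
  show "x \<in> I <+>\<^bsub>R\<^esub> PIdl x" using sum_ideal_upper(2)[OF assms(1) p] cgenideal_self[OF assms(2)] by blast
  show "\<exists>a\<in>I. \<exists>r\<in>carrier R. z = a \<oplus> r \<otimes> x" if "z \<in> I <+>\<^bsub>R\<^esub> PIdl x" for z
    using that by (auto simp: sum_ideal_mem_iff cgenideal_def)
qed

lemma (in cring) colon_ideal:
  assumes "ideal A R" "x \<in> carrier R"
  shows "ideal {r \<in> carrier R. r \<otimes> x \<in> A} R"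
  by (rule cring_idealI)
    (use assms in \<open>auto simp: ideal_zero_mem l_distr ideal_add_mem m_assoc ideal.I_l_closed\<close>)

lemma (in cring) ideal_pow_ideal:
  assumes "ideal I R" shows "ideal (ideal_pow R I n) R"
  by (induction n) (auto simp: oneideal ideal_prod_is_ideal assms)

lemma (in cring) ideal_pow_Suc_subset:
  assumes "ideal I R" shows "ideal_pow R I (Suc n) \<subseteq> ideal_pow R I n"
  using ideal_prod_inter[OF ideal_pow_ideal[OF assms] assms] by auto

lemma (in cring) nat_pow_mem_ideal_pow:
  assumes "ideal I R" "x \<in> I" shows "x [^] n \<in> ideal_pow R I n"
  by (induction n) (auto simp: assms intro: ideal_prod.prod)

lemma (in cring) ideal_mem_cancel_add:
  assumes "ideal I R" "a \<in> I" "b \<in> carrier R" "a \<oplus> b \<in> I"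
  shows "b \<in> I"
proof -
  have "a \<in> carrier R" using assms ideal.Icarr by fast
  then have "b = (a \<oplus> b) \<ominus> a" using assms(3) by algebra
  then show ?thesis using ideal_minus_mem[OF assms(1,4,2)] by simp
qed

lemma (in cring) jacobson_radical_ideal: "ideal (jacobson_radical R) R"
  unfolding jacobson_radical_def
proof (rule cring_idealI)
  have *: "ideal I R" if "maximalideal I R" for I using that by (rule maximalideal.axioms(1))
  show "\<zero> \<in> carrier R \<inter> \<Inter> {I. maximalideal I R}"
    by (auto dest!: * simp: ideal_zero_mem)
  show "a \<oplus> b \<in> carrier R \<inter> \<Inter> {I. maximalideal I R}"
    if "a \<in> carrier R \<inter> \<Inter> {I. maximalideal I R}" "b \<in> carrier R \<inter> \<Inter> {I. maximalideal I R}" for a b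
    using that * by (auto intro: ideal_add_mem)
  show "r \<otimes> a \<in> carrier R \<inter> \<Inter> {I. maximalideal I R}"
    if "a \<in> carrier R \<inter> \<Inter> {I. maximalideal I R}" "r \<in> carrier R" for a r
    using that * by (auto intro: ideal.I_l_closed)
qed auto

text \<open>Take one element outside \<open>P\<close> from each ideal of \<open>F\<close>: the
  product lies in all of them, and primality keeps it outside \<open>P\<close>. Applied to the
  maximal ideals of a semilocal ring, this shows that a prime containing the Jacobson radical
  contains a maximal ideal.\<close>

lemma (in cring) prime_avoids_finite_intersection:
  assumes P: "primeideal P R" and "finite F" "\<And>I. I \<in> F \<Longrightarrow> ideal I R"
    and "\<And>I. I \<in> F \<Longrightarrow> \<not> I \<subseteq> P"
  shows "\<exists>x\<in>carrier R - P. \<forall>I\<in>F. x \<in> I"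
  using assms(2-)
proof (induction F rule: finite_induct)
  case empty
  have "\<one> \<notin> P" using ideal.one_imp_carrier primeideal.I_notcarr P primeideal.axioms(1) by metis
  then show ?case by auto
next
  case (insert I F)
  then obtain x where x: "x \<in> carrier R" "x \<notin> P" "\<forall>I\<in>F. x \<in> I" by auto
  obtain y where y: "y \<in> I" "y \<notin> P" using insert.prems by blast
  have yc: "y \<in> carrier R" using y ideal.Icarr[OF insert.prems(1)] by blast
  have "x \<otimes> y \<notin> P" using primeideal.I_prime[OF P x(1) yc] x y by blast
  moreover have "x \<otimes> y \<in> I" using insert.prems y x by (simp add: ideal.I_l_closed)
  moreover have "\<forall>I\<in>F. x \<otimes> y \<in> I" using insert.prems x yc by (simp add: ideal.I_r_closed)
  ultimately show ?case using x yc by auto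
qed

lemma (in cring) primeideal_nat_pow:
  assumes "primeideal P R" "x \<in> carrier R" "x [^] (n::nat) \<in> P"
  shows "x \<in> P"
  using assms(3)
proof (induction n)
  case 0
  then show ?case
    using ideal.one_imp_carrier primeideal.I_notcarr assms(1) primeideal.axioms(1) by fastforce
next
  case (Suc n)
  then show ?case using primeideal.I_prime[OF assms(1), of "x [^] n" x] assms(2) by auto
qed

section \<open>Krull intersection over noetherian semilocal rings\<close>

locale noetherian_cring = cring R + noetherian_ring R for R (structure)
begin

text \<open>In a noetherian ring the union of a nonempty chain of ideals is a member of the chain,
  so Zorn's lemma applies to every property of ideals, whether or not it is preserved by
  unions.\<close>

lemma exists_maximal_ideal_with:
  assumes "\<And>I. \<phi> I \<Longrightarrow> ideal I R" "\<phi> I"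
  obtains M where "\<phi> M" "\<And>X. \<phi> X \<Longrightarrow> M \<subseteq> X \<Longrightarrow> X = M"
proof -
  have "\<exists>M\<in>Collect \<phi>. \<forall>X\<in>Collect \<phi>. M \<subseteq> X \<longrightarrow> X = M"
  proof (rule subset_Zorn_nonempty)
    show "Collect \<phi> \<noteq> {}" using assms(2) by blast
    fix C assume C: "C \<noteq> {}" "subset.chain (Collect \<phi>) C"
    then have "subset.chain {I. ideal I R} C"
      using assms(1) by (auto simp: subset_chain_def)
    from ideal_chain_is_trivial[OF C(1) this] show "\<Union>C \<in> Collect \<phi>"
      using C(2) by (auto simp: subset_chain_def)
  qed
  then show ?thesis using that by blast
qed

lemma ideal_ascending_stable:
  fixes I :: "nat \<Rightarrow> 'a set"
  assumes "\<And>n. ideal (I n) R" "\<And>n. I n \<subseteq> I (Suc n)"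
  shows "\<exists>n. \<forall>k\<ge>n. I k = I n"
proof -
  obtain M where "M \<in> range I" and max: "\<And>X. X \<in> range I \<Longrightarrow> M \<subseteq> X \<Longrightarrow> X = M"
    using exists_maximal_ideal_with[of "\<lambda>X. X \<in> range I" "I 0"] assms(1) by blast
  then obtain n where n: "M = I n" by blast
  have "I k = I n" if "k \<ge> n" for k
    using max[of "I k"] lift_Suc_mono_le[of I n k] assms(2) that n by auto
  then show ?thesis by blast
qed

text \<open>The colon ideal of \<open>y\<close> into \<open>L\<close> contains
  \<open>\<one> \<ominus> x\<close>. If it were proper, a maximal ideal above it would contain
  \<open>x\<close> as well, hence \<open>\<one>\<close>. This plays the role of invertibility of
  \<open>\<one> \<ominus> x\<close>.\<close>

lemma jacobson_cancel:
  assumes x: "x \<in> jacobson_radical R" and L: "ideal L R" and y: "y \<in> carrier R"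
    and "(\<one> \<ominus> x) \<otimes> y \<in> L"
  shows "y \<in> L"
proof (rule ccontr)
  assume nL: "y \<notin> L"
  let ?A = "{r \<in> carrier R. r \<otimes> y \<in> L}"
  have A: "ideal ?A R" by (rule colon_ideal[OF L y])
  have "\<one> \<notin> ?A" using nL y by auto
  then obtain M where M': "ideal M R \<and> ?A \<subseteq> M \<and> \<one> \<notin> M"
      and max: "\<And>X. ideal X R \<and> ?A \<subseteq> X \<and> \<one> \<notin> X \<Longrightarrow> M \<subseteq> X \<Longrightarrow> X = M"
    using exists_maximal_ideal_with[of "\<lambda>I. ideal I R \<and> ?A \<subseteq> I \<and> \<one> \<notin> I" ?A] A by blast
  then have M: "ideal M R" "?A \<subseteq> M" "\<one> \<notin> M" by blast+
  have "maximalideal M R"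
  proof (rule maximalidealI[OF M(1)])
    show "carrier R \<noteq> M" using M(3) by auto
    show "X = M \<or> X = carrier R" if "ideal X R" "M \<subseteq> X" for X
      using max[of X] that M(2) ideal.one_imp_carrier[OF that(1)] by blast
  qed
  then have xM: "x \<in> M" and xc: "x \<in> carrier R" using x by (auto simp: jacobson_radical_def)
  have "\<one> \<ominus> x \<in> M" using assms(4) M(2) xc by auto
  then have "(\<one> \<ominus> x) \<oplus> x \<in> M" using xM ideal_add_mem[OF M(1)] by blast
  moreover have "(\<one> \<ominus> x) \<oplus> x = \<one>" using xc by algebra
  ultimately show False using M(3) by simp
qed

text \<open>Enlarging \<open>I\<close> as far as possible without swallowing \<open>N\<close> yields
  a quotient in which every nonzero ideal contains the image of \<open>N\<close>.\<close>

lemma exists_ideal_maximal_not_containing: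
  assumes "ideal I R" "\<not> N \<subseteq> I"
  obtains L where "ideal L R" "I \<subseteq> L" "\<not> N \<subseteq> L"
    "\<And>X. ideal X R \<Longrightarrow> L \<subseteq> X \<Longrightarrow> X \<noteq> L \<Longrightarrow> N \<subseteq> X"
proof -
  obtain L where L: "ideal L R \<and> I \<subseteq> L \<and> \<not> N \<subseteq> L"
      and max: "\<And>X. ideal X R \<and> I \<subseteq> X \<and> \<not> N \<subseteq> X \<Longrightarrow> L \<subseteq> X \<Longrightarrow> X = L"
    using exists_maximal_ideal_with[of "\<lambda>X. ideal X R \<and> I \<subseteq> X \<and> \<not> N \<subseteq> X" I] assms by blast
  show ?thesis
  proof (rule that[of L])
    show "N \<subseteq> X" if "ideal X R" "L \<subseteq> X" "X \<noteq> L" for X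
      using max[of X] that L by blast
  qed (use L in auto)
qed

text \<open>A Nakayama argument: if \<open>x \<otimes> y\<close> were outside \<open>L\<close>, then
  maximality would give \<open>y = a \<oplus> r \<otimes> (x \<otimes> y)\<close> with
  \<open>a\<close> in \<open>L\<close>. So
  \<open>(\<one> \<ominus> r \<otimes> x) \<otimes> y\<close> lies in \<open>L\<close>, and
  cancelling the first factor puts \<open>y\<close>, and with it \<open>x \<otimes> y\<close>, into
  \<open>L\<close>.\<close>

lemma jacobson_mult_mem_maximal:
  assumes L: "ideal L R" and N: "N \<subseteq> carrier R"
    and max: "\<And>X. ideal X R \<Longrightarrow> L \<subseteq> X \<Longrightarrow> X \<noteq> L \<Longrightarrow> N \<subseteq> X"
    and x: "x \<in> jacobson_radical R" and y: "y \<in> N"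
  shows "x \<otimes> y \<in> L"
proof (rule ccontr)
  assume nL: "x \<otimes> y \<notin> L"
  have xc: "x \<in> carrier R" using x by (simp add: jacobson_radical_def)
  have yc: "y \<in> carrier R" using y N by auto
  note adj = ideal_adjoin[OF L, of "x \<otimes> y"]
  have "y \<in> L <+>\<^bsub>R\<^esub> PIdl (x \<otimes> y)" using max[OF adj(1,2)] adj(3) xc yc nL y by auto
  then obtain a r where a: "a \<in> L" "r \<in> carrier R" "y = a \<oplus> r \<otimes> (x \<otimes> y)"
    using adj(4) xc yc by blast
  have ac: "a \<in> carrier R" using ideal.Icarr[OF L a(1)] .
  have "(\<one> \<ominus> r \<otimes> x) \<otimes> y = y \<ominus> r \<otimes> (x \<otimes> y)" using a(2) xc yc by algebra
  also have "\<dots> = (a \<oplus> r \<otimes> (x \<otimes> y)) \<ominus> r \<otimes> (x \<otimes> y)" using a(3) by simp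
  also have "\<dots> = a" using a(2) ac xc yc by algebra
  finally have "y \<in> L"
    using jacobson_cancel[of "r \<otimes> x" L y] ideal.I_l_closed[OF jacobson_radical_ideal x a(2)] L yc a(1)
    by simp
  then show False using nL ideal.I_l_closed[OF L _ xc] by blast
qed

section \<open>Artinian quotients of a semilocal noetherian ring\<close>

text \<open>Artinianness of \<open>R / A\<close>, phrased for the ideals of \<open>R\<close> containing \<open>A\<close>.\<close>
definition descending_stable :: "'a set \<Rightarrow> bool" where
  "descending_stable A \<longleftrightarrow> (\<forall>I :: nat \<Rightarrow> 'a set.
     (\<forall>n. ideal (I n) R \<and> A \<subseteq> I n \<and> I (Suc n) \<subseteq> I n) \<longrightarrow> (\<exists>n. \<forall>k\<ge>n. I k = I n))"

text \<open>An extension of artinian modules: \<open>(A + Rx) / A\<close> is isomorphic to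
  \<open>R\<close> modulo the colon ideal, hence simple, and \<open>R / (A + Rx)\<close> is
  artinian. A descending chain is therefore eventually constant modulo \<open>x\<close>, and its
  part inside the simple module is governed by whether \<open>x\<close> belongs to it.\<close>

lemma descending_stable_adjoin:
  assumes A: "ideal A R" and x: "x \<in> carrier R"
    and Q: "maximalideal {r \<in> carrier R. r \<otimes> x \<in> A} R"
    and st: "descending_stable (A <+>\<^bsub>R\<^esub> PIdl x)"
  shows "descending_stable A"
  unfolding descending_stable_def
proof (intro allI impI)
  fix I :: "nat \<Rightarrow> 'a set"
  assume I: "\<forall>n. ideal (I n) R \<and> A \<subseteq> I n \<and> I (Suc n) \<subseteq> I n"
  let ?Q = "{r \<in> carrier R. r \<otimes> x \<in> A}"
  have anti: "I k \<subseteq> I n" if "n \<le> k" for n k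
    using lift_Suc_antimono_le[of I] I that by blast
  have "\<exists>n. \<forall>k\<ge>n. I k <+>\<^bsub>R\<^esub> PIdl x = I n <+>\<^bsub>R\<^esub> PIdl x"
  proof -
    have "ideal (I n <+>\<^bsub>R\<^esub> PIdl x) R \<and> A <+>\<^bsub>R\<^esub> PIdl x \<subseteq> I n <+>\<^bsub>R\<^esub> PIdl x
        \<and> I (Suc n) <+>\<^bsub>R\<^esub> PIdl x \<subseteq> I n <+>\<^bsub>R\<^esub> PIdl x" for n
      using I ideal_adjoin(1)[OF _ x] by (auto simp: sum_ideal_mem_iff subset_iff)
    then show ?thesis
      using st[unfolded descending_stable_def, rule_format, of "\<lambda>n. I n <+>\<^bsub>R\<^esub> PIdl x"] by blast
  qed
  then obtain n0 where n0: "\<And>k. k \<ge> n0 \<Longrightarrow> I k <+>\<^bsub>R\<^esub> PIdl x = I n0 <+>\<^bsub>R\<^esub> PIdl x" by blast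
  \<comment> \<open>The chain decreases, so once \<open>x\<close> has left it, it never
    returns.\<close>
  have "\<exists>n1. (\<forall>k\<ge>n1. x \<in> I k) \<or> (\<forall>k\<ge>n1. x \<notin> I k)" using anti by blast
  then obtain n1 where n1: "(\<forall>k\<ge>n1. x \<in> I k) \<or> (\<forall>k\<ge>n1. x \<notin> I k)" by blast
  define n where "n = max n0 n1"
  have "I n \<subseteq> I k" if k: "k \<ge> n" for k
  proof
    fix y assume y: "y \<in> I n"
    have In: "ideal (I n) R" and Ik: "ideal (I k) R" and Ak: "A \<subseteq> I k" using I by auto
    have "y \<in> I k <+>\<^bsub>R\<^esub> PIdl x"
      using n0[of n] n0[of k] k y ideal_adjoin(2)[OF In x] by (auto simp: n_def)
    then obtain z r where z: "z \<in> I k" "r \<in> carrier R" "y = z \<oplus> r \<otimes> x"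
      using ideal_adjoin(4)[OF Ik x] by blast
    have "r \<otimes> x \<in> I k"
    proof (cases "x \<in> I k")
      case True then show ?thesis using z Ik by (simp add: ideal.I_l_closed)
    next
      case False
      then have xn: "x \<notin> I n" using n1 k by (auto simp: n_def)
      have rx: "r \<otimes> x \<in> I n"
        using ideal_mem_cancel_add[OF In, of z "r \<otimes> x"] z y anti[OF k] x by auto
      \<comment> \<open>The multipliers sending \<open>x\<close> into \<open>I n\<close> form a
        proper ideal above the maximal ideal \<open>?Q\<close>, hence equal it. So
        \<open>r \<otimes> x\<close> already lies in \<open>A\<close>, which is contained in every
        member of the chain.\<close>
      have "?Q \<subseteq> {r \<in> carrier R. r \<otimes> x \<in> I n}" using I by auto
      moreover have "\<one> \<notin> {r \<in> carrier R. r \<otimes> x \<in> I n}" using xn x by simp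
      then have "{r \<in> carrier R. r \<otimes> x \<in> I n} \<noteq> carrier R" using one_closed by blast
      ultimately have "?Q = {r \<in> carrier R. r \<otimes> x \<in> I n}"
        using maximalideal.I_maximal[OF Q colon_ideal[OF In x]] by auto
      then show ?thesis using rx z(2) Ak by auto
    qed
    then show "y \<in> I k" using z ideal_add_mem[OF Ik] by simp
  qed
  then show "\<exists>n. \<forall>k\<ge>n. I k = I n" using anti by blast
qed

text \<open>Existence of an associated prime of \<open>R / A\<close>: among the annihilators of
  nonzero elements a maximal one is prime, since the annihilator of \<open>b \<otimes> x\<close>
  contains that of \<open>x\<close> and equals it as soon as \<open>b \<otimes> x\<close> is nonzero
  modulo \<open>A\<close>.\<close>

lemma exists_prime_colon:
  assumes A: "ideal A R" and "A \<noteq> carrier R"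
  obtains x where "x \<in> carrier R" "x \<notin> A" "primeideal {r \<in> carrier R. r \<otimes> x \<in> A} R"
proof -
  define col where "col x = {r \<in> carrier R. r \<otimes> x \<in> A}" for x
  have idl: "ideal (col x) R" if "x \<in> carrier R" for x
    unfolding col_def using colon_ideal[OF A that] .
  have "carrier R - A \<noteq> {}" using assms(2) ideal.Icarr[OF A] by (auto simp: set_eq_iff)
  then obtain z where "col z \<in> col ` (carrier R - A)" by blast
  then obtain M where "M \<in> col ` (carrier R - A)"
      and M: "\<And>X. X \<in> col ` (carrier R - A) \<Longrightarrow> M \<subseteq> X \<Longrightarrow> X = M"
    using exists_maximal_ideal_with[of "\<lambda>X. X \<in> col ` (carrier R - A)" "col z"] idl by blast
  then obtain x where x: "x \<in> carrier R" "x \<notin> A" and "M = col x" by blast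
  with M have max: "col y = col x" if "y \<in> carrier R" "y \<notin> A" "col x \<subseteq> col y" for y
    using that by blast
  have "primeideal (col x) R"
  proof (rule primeidealI[OF idl[OF x(1)] cring_axioms])
    have "\<one> \<notin> col x" using x by (simp add: col_def)
    then show "carrier R \<noteq> col x" using one_closed by blast
    fix a b assume ab: "a \<in> carrier R" "b \<in> carrier R" "a \<otimes> b \<in> col x"
    show "a \<in> col x \<or> b \<in> col x"
    proof (rule disjCI)
      assume "b \<notin> col x"
      then have bx: "b \<otimes> x \<notin> A" using ab by (simp add: col_def)
      have "col x \<subseteq> col (b \<otimes> x)"
        using ideal.I_l_closed[OF A _ ab(2)] m_lcomm[OF _ ab(2) x(1)] by (auto simp: col_def)
      then have "col (b \<otimes> x) = col x" using max bx ab x by simp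
      moreover have "a \<in> col (b \<otimes> x)" using ab x by (simp add: col_def m_assoc)
      ultimately show "a \<in> col x" by simp
    qed
  qed
  then show ?thesis using that x unfolding col_def by blast
qed

text \<open>Noetherian induction on a largest counterexample \<open>B\<close>. An associated prime
  of \<open>R / B\<close> contains the radical, since radical elements are nilpotent modulo
  \<open>B\<close>, and is therefore maximal. This splits a simple submodule off
  \<open>R / B\<close>, while the remaining quotient is artinian by the choice of
  \<open>B\<close>.\<close>

lemma descending_stable_if_jacobson_nil:
  assumes "semilocal R" "ideal A R"
    and "\<And>x. x \<in> jacobson_radical R \<Longrightarrow> \<exists>n::nat. x [^] n \<in> A"
  shows "descending_stable A"
proof (rule ccontr)
  define S where "S = {A. ideal A R \<and> \<not> descending_stable A \<and>
    (\<forall>x\<in>jacobson_radical R. \<exists>n::nat. x [^] n \<in> A)}"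
  assume "\<not> descending_stable A"
  then have "A \<in> S" using assms by (simp add: S_def)
  moreover have "ideal X R" if "X \<in> S" for X using that by (simp add: S_def)
  ultimately obtain B where B: "B \<in> S" and max: "\<And>X. X \<in> S \<Longrightarrow> B \<subseteq> X \<Longrightarrow> X = B"
    using exists_maximal_ideal_with[of "\<lambda>X. X \<in> S" A] by blast
  have iB: "ideal B R" and nB: "\<not> descending_stable B"
    and rad: "\<forall>x\<in>jacobson_radical R. \<exists>n::nat. x [^] n \<in> B" using B by (auto simp: S_def)
  have "B \<noteq> carrier R"
  proof
    assume "B = carrier R"
    then have "descending_stable B"
      unfolding descending_stable_def by (metis ideal.Icarr subsetI subset_antisym)
    then show False using nB by simp
  qed
  then obtain x where x: "x \<in> carrier R" "x \<notin> B" and P: "primeideal {r \<in> carrier R. r \<otimes> x \<in> B} R"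
    using exists_prime_colon[OF iB] by blast
  let ?P = "{r \<in> carrier R. r \<otimes> x \<in> B}"
  have JP: "jacobson_radical R \<subseteq> ?P"
  proof
    fix y assume y: "y \<in> jacobson_radical R"
    then have yc: "y \<in> carrier R" by (simp add: jacobson_radical_def)
    obtain n :: nat where "y [^] n \<in> B" using rad y by blast
    then have "y [^] n \<in> ?P" using x yc iB by (simp add: ideal.I_r_closed)
    then show "y \<in> ?P" by (rule primeideal_nat_pow[OF P yc])
  qed
  \<comment> \<open>Otherwise some element common to the finitely many maximal ideals, that is, an
    element of the radical, would lie outside \<open>?P\<close>.\<close>
  have "\<exists>Q. maximalideal Q R \<and> Q \<subseteq> ?P"
  proof (rule ccontr)
    assume "\<not> ?thesis"
    then obtain z where "z \<in> carrier R - ?P" "\<forall>I\<in>{I. maximalideal I R}. z \<in> I"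
      using prime_avoids_finite_intersection[OF P, of "{I. maximalideal I R}"] assms(1)
        maximalideal.axioms(1) unfolding semilocal_def by blast
    then show False using JP by (auto simp: jacobson_radical_def)
  qed
  then obtain Q where Q: "maximalideal Q R" "Q \<subseteq> ?P" by blast
  have "?P = Q"
    using maximalideal.I_maximal[OF Q(1) primeideal.axioms(1)[OF P] Q(2)]
      primeideal.I_notcarr[OF P] by auto
  then have mP: "maximalideal ?P R" using Q by simp
  note adj = ideal_adjoin[OF iB x(1)]
  \<comment> \<open>The adjoined ideal is strictly larger than \<open>B\<close>, so it cannot be
    another counterexample.\<close>
  have "B <+>\<^bsub>R\<^esub> PIdl x \<notin> S" using max adj(2,3) x(2) by blast
  then have "descending_stable (B <+>\<^bsub>R\<^esub> PIdl x)" using adj(1,2) rad by (auto simp: S_def)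
  then show False using descending_stable_adjoin[OF iB x(1) mP] nB by blast
qed

text \<open>The ideals \<open>J^n + L\<close> become stationary because \<open>R / L\<close> is
  artinian. If the stationary power \<open>N\<close> were not in \<open>L\<close>, enlarge
  \<open>L\<close> to an \<open>X\<close> maximal without containing \<open>N\<close>. Then
  \<open>N J\<close> lies in \<open>X\<close>, and stationarity gives that \<open>N\<close> lies in
  \<open>N J + L\<close>, hence in \<open>X\<close>, a contradiction.\<close>

lemma jacobson_pow_subset:
  assumes "semilocal R" and L: "ideal L R"
    and "\<And>x. x \<in> jacobson_radical R \<Longrightarrow> \<exists>n::nat. x [^] n \<in> L"
  shows "\<exists>n. ideal_pow R (jacobson_radical R) n \<subseteq> L"
proof -
  let ?J = "jacobson_radical R"
  note pow = ideal_pow_ideal[OF jacobson_radical_ideal]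
  have "ideal (ideal_pow R ?J n <+>\<^bsub>R\<^esub> L) R \<and> L \<subseteq> ideal_pow R ?J n <+>\<^bsub>R\<^esub> L \<and>
      ideal_pow R ?J (Suc n) <+>\<^bsub>R\<^esub> L \<subseteq> ideal_pow R ?J n <+>\<^bsub>R\<^esub> L" for n
    using add_ideals[OF pow L] sum_ideal_upper(2)[OF pow L]
      ideal_pow_Suc_subset[OF jacobson_radical_ideal]
    by (auto simp: sum_ideal_mem_iff subset_iff)
  then obtain n where n: "\<forall>k\<ge>n. ideal_pow R ?J k <+>\<^bsub>R\<^esub> L = ideal_pow R ?J n <+>\<^bsub>R\<^esub> L"
    using descending_stable_if_jacobson_nil[OF assms, unfolded descending_stable_def, rule_format,
        of "\<lambda>n. ideal_pow R ?J n <+>\<^bsub>R\<^esub> L"] by blast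
  let ?N = "ideal_pow R ?J n"
  have "?N \<subseteq> L"
  proof (rule ccontr)
    assume "\<not> ?N \<subseteq> L"
    then obtain X where X: "ideal X R" "L \<subseteq> X" "\<not> ?N \<subseteq> X"
      and max: "\<And>Y. ideal Y R \<Longrightarrow> X \<subseteq> Y \<Longrightarrow> Y \<noteq> X \<Longrightarrow> ?N \<subseteq> Y"
      using exists_ideal_maximal_not_containing[OF L] by blast
    have Nc: "?N \<subseteq> carrier R" using ideal.Icarr[OF pow] by blast
    have Jc: "?J \<subseteq> carrier R" by (auto simp: jacobson_radical_def)
    have "z \<in> X" if "z \<in> ideal_prod R ?N ?J" for z
      using that
    proof (induction rule: ideal_prod.induct)
      case (prod i j)
      then show ?case
        using jacobson_mult_mem_maximal[OF X(1) Nc max, of j i] Nc Jc by (auto simp: m_comm subset_iff)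
    next
      case (sum s1 s2)
      then show ?case using ideal_add_mem[OF X(1)] by blast
    qed
    then have "ideal_pow R ?J (Suc n) <+>\<^bsub>R\<^esub> L \<subseteq> X"
      using sum_ideal_least[OF X(1) _ X(2)] by auto
    moreover have "?N \<subseteq> ideal_pow R ?J (Suc n) <+>\<^bsub>R\<^esub> L"
      using n sum_ideal_upper(1)[OF pow L, of n] by (metis le_Suc_eq order_refl)
    ultimately show False using X(3) by blast
  qed
  then show ?thesis ..
qed

text \<open>An ideal \<open>L\<close> containing \<open>I\<close> and maximal with \<open>y \<notin> L\<close> satisfies \<open>J y \<subseteq> L\<close>; if no power of
  some \<open>x \<in> J\<close> lay in \<open>L\<close>, then \<open>y \<in> L + R x\<^sup>n\<close> for a stable \<open>n\<close>, and \<open>x y \<in> L\<close> would force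
  \<open>y \<in> L\<close>. So \<open>L\<close> contains a power of \<open>J\<close>.\<close>
lemma krull_intersection:
  assumes "semilocal R" and I: "ideal I R"
    and y: "\<And>k. y \<in> I <+>\<^bsub>R\<^esub> ideal_pow R (jacobson_radical R) k"
  shows "y \<in> I"
proof (rule ccontr)
  let ?J = "jacobson_radical R"
  note pow = ideal_pow_ideal[OF jacobson_radical_ideal]
  assume "y \<notin> I"
  then obtain L where L: "ideal L R" "I \<subseteq> L" "y \<notin> L"
    and max: "\<And>X. ideal X R \<Longrightarrow> L \<subseteq> X \<Longrightarrow> X \<noteq> L \<Longrightarrow> {y} \<subseteq> X"
    using exists_ideal_maximal_not_containing[OF I, of "{y}"] by auto
  have yc: "y \<in> carrier R" using y[of 0] ideal.Icarr[OF add_ideals[OF I pow]] by blast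
  have "\<exists>n::nat. x [^] n \<in> L" if x: "x \<in> ?J" for x
  proof -
    have xc: "x \<in> carrier R" using x by (simp add: jacobson_radical_def)
    have xy: "x \<otimes> y \<in> L" using jacobson_mult_mem_maximal[OF L(1) _ max x] yc by simp
    \<comment> \<open>These colon ideals ascend; where they are stable, one factor \<open>x\<close>
      can be cancelled from \<open>r \<otimes> x [^] Suc n\<close>.\<close>
    let ?C = "\<lambda>n::nat. {r \<in> carrier R. r \<otimes> x [^] n \<in> L}"
    have "?C n \<subseteq> ?C (Suc n)" for n
      using xc ideal.I_r_closed[OF L(1) _ xc] by (auto simp: m_assoc[symmetric])
    then obtain n where stable: "\<forall>k\<ge>n. ?C k = ?C n"
      using ideal_ascending_stable[of ?C] colon_ideal[OF L(1)] xc by auto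
    have n: "?C (Suc n) = ?C n" by (rule stable[rule_format]) simp
    have "x [^] n \<in> L"
    proof (rule ccontr)
      assume nL: "x [^] n \<notin> L"
      note adj = ideal_adjoin[OF L(1), of "x [^] n"]
      have "y \<in> L <+>\<^bsub>R\<^esub> PIdl (x [^] n)" using max[OF adj(1,2)] adj(3) xc nL by auto
      then obtain a r where a: "a \<in> L" "r \<in> carrier R" "y = a \<oplus> r \<otimes> x [^] n"
        using adj(4) xc by blast
      have ac: "a \<in> carrier R" using ideal.Icarr[OF L(1) a(1)] .
      have "x \<otimes> y = x \<otimes> a \<oplus> r \<otimes> x [^] (Suc n)"
        using a ac xc by (simp add: r_distr m_ac)
      then have "r \<otimes> x [^] (Suc n) \<in> L"
        using ideal_mem_cancel_add[OF L(1) ideal.I_l_closed[OF L(1) a(1) xc], of "r \<otimes> x [^] (Suc n)"]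
          xy a(2) xc by simp
      then have "r \<otimes> x [^] n \<in> L" using n a(2) by blast
      then show False using L(3) a ideal_add_mem[OF L(1)] by blast
    qed
    then show ?thesis ..
  qed
  then obtain k where k: "ideal_pow R ?J k \<subseteq> L" using jacobson_pow_subset[OF assms(1) L(1)] by blast
  then have "I <+>\<^bsub>R\<^esub> ideal_pow R ?J k \<subseteq> L" using sum_ideal_least[OF L(1,2)] by blast
  then show False using y L(3) by blast
qed

end

section \<open>Linear compactness\<close>

text \<open>A nonempty set closed under \<open>x + r (y - z)\<close> is a coset of the ideal of its
  differences.\<close>

lemma (in cring) affine_directions_ideal:
  assumes "C \<subseteq> carrier R" "C \<noteq> {}"
    and aff: "\<And>x y z r. x \<in> C \<Longrightarrow> y \<in> C \<Longrightarrow> z \<in> C \<Longrightarrow> r \<in> carrier R \<Longrightarrow>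
      x \<oplus> (r \<otimes> y \<oplus> (\<ominus> r) \<otimes> z) \<in> C"
  shows "ideal {d \<ominus> e | d e. d \<in> C \<and> e \<in> C} R"
    and "\<And>x v. x \<in> C \<Longrightarrow> v \<in> {d \<ominus> e | d e. d \<in> C \<and> e \<in> C} \<Longrightarrow> x \<oplus> v \<in> C"
proof -
  have car: "\<And>x. x \<in> C \<Longrightarrow> x \<in> carrier R" using assms(1) by blast
  have aff': "x \<oplus> r \<otimes> (y \<ominus> z) \<in> C" if "x \<in> C" "y \<in> C" "z \<in> C" "r \<in> carrier R" for x y z r
  proof -
    have "x \<oplus> r \<otimes> (y \<ominus> z) = x \<oplus> (r \<otimes> y \<oplus> (\<ominus> r) \<otimes> z)"
      using car[OF that(1)] car[OF that(2)] car[OF that(3)] that(4) by algebra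
    then show ?thesis using aff[OF that] by simp
  qed
  let ?I = "{d \<ominus> e | d e. d \<in> C \<and> e \<in> C}"
  show tr: "x \<oplus> v \<in> C" if x: "x \<in> C" and v: "v \<in> ?I" for x v
  proof -
    obtain d e where de: "d \<in> C" "e \<in> C" "v = d \<ominus> e" using v by blast
    then have "\<one> \<otimes> (d \<ominus> e) = v" using car by simp
    then show ?thesis using aff'[OF x de(1,2) one_closed] by simp
  qed
  obtain c where c: "c \<in> C" using assms(2) by blast
  have cc: "c \<in> carrier R" by (rule car[OF c])
  \<comment> \<open>With a base point \<open>c\<close> fixed, directions are recognised by
    translating \<open>c\<close>; each closure property of the ideal then becomes a membership in
    \<open>C\<close>.\<close>
  have dirI: "v \<in> ?I" if "v \<in> carrier R" "c \<oplus> v \<in> C" for v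
  proof -
    have "v = (c \<oplus> v) \<ominus> c" using cc that(1) by algebra
    then show ?thesis using that(2) c by blast
  qed
  have sub: "?I \<subseteq> carrier R" using car by auto
  show "ideal ?I R"
  proof (rule cring_idealI[OF sub])
    show "\<zero> \<in> ?I" by (rule dirI) (use c cc in auto)
    show "a \<oplus> b \<in> ?I" if "a \<in> ?I" "b \<in> ?I" for a b
    proof (rule dirI)
      have ab: "a \<in> carrier R" "b \<in> carrier R" using that sub by blast+
      then show "a \<oplus> b \<in> carrier R" by simp
      have "c \<oplus> a \<oplus> b \<in> C" using tr tr[OF c] that by blast
      then show "c \<oplus> (a \<oplus> b) \<in> C" using ab cc by (simp add: a_assoc)
    qed
    show "r \<otimes> a \<in> ?I" if a: "a \<in> ?I" and r: "r \<in> carrier R" for a r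
    proof (rule dirI)
      obtain d e where "d \<in> C" "e \<in> C" "a = d \<ominus> e" using a by blast
      then show "c \<oplus> r \<otimes> a \<in> C" using aff'[OF c _ _ r] by blast
      have "a \<in> carrier R" using a sub by blast
      then show "r \<otimes> a \<in> carrier R" using r by simp
    qed
  qed
qed

section \<open>Linear compactness of the base ring\<close>

context noetherian_cring
begin

lemma ring_linearly_compact:
  fixes C :: "nat \<Rightarrow> 'a set"
  assumes sl: "semilocal R" and compl: "adically_complete R (jacobson_radical R)"
    and C: "\<And>n. C n \<subseteq> carrier R" "\<And>n. C n \<noteq> {}" "\<And>n. C (Suc n) \<subseteq> C n"
    and aff: "\<And>n x y z r. x \<in> C n \<Longrightarrow> y \<in> C n \<Longrightarrow> z \<in> C n \<Longrightarrow> r \<in> carrier R \<Longrightarrow>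
      x \<oplus> (r \<otimes> y \<oplus> (\<ominus> r) \<otimes> z) \<in> C n"
  shows "\<exists>x\<in>carrier R. \<forall>n. x \<in> C n"
proof -
  define J where "J k = ideal_pow R (jacobson_radical R) k" for k
  define I where "I n = {d \<ominus> e | d e. d \<in> C n \<and> e \<in> C n}" for n
  have iI: "ideal (I n) R" for n
    unfolding I_def by (rule affine_directions_ideal(1)[OF C(1,2) aff])
  have tr: "x \<oplus> v \<in> C n" if "x \<in> C n" "v \<in> I n" for x v n
    using affine_directions_ideal(2)[OF C(1,2) aff, of n x v] that unfolding I_def by blast
  have diff: "x \<ominus> y \<in> I n" if "x \<in> C n" "y \<in> C n" for x y n using that unfolding I_def by blast
  have iJ: "ideal (J k) R" for k unfolding J_def by (rule ideal_pow_ideal[OF jacobson_radical_ideal])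
  have antiC: "C k \<subseteq> C n" if "n \<le> k" for n k using lift_Suc_antimono_le[of C] C(3) that by blast
  have antiI: "I k \<subseteq> I n" if "n \<le> k" for n k using antiC[OF that] unfolding I_def by blast
  have car: "x \<in> carrier R" if "x \<in> C n" for x n using that C(1) by blast
  have ex_stable: "\<exists>n. \<forall>l\<ge>n. I l <+>\<^bsub>R\<^esub> J k = I n <+>\<^bsub>R\<^esub> J k" for k
  proof -
    \<comment> \<open>The \<open>k\<close>-th power of any radical element lies in
      \<open>J k\<close>, so the quotient by \<open>J k\<close> is artinian.\<close>
    have "descending_stable (J k)"
      by (rule descending_stable_if_jacobson_nil[OF sl iJ])
        (use nat_pow_mem_ideal_pow[OF jacobson_radical_ideal] in \<open>auto simp: J_def\<close>)
    moreover have "ideal (I n <+>\<^bsub>R\<^esub> J k) R \<and> J k \<subseteq> I n <+>\<^bsub>R\<^esub> J k \<and>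
        I (Suc n) <+>\<^bsub>R\<^esub> J k \<subseteq> I n <+>\<^bsub>R\<^esub> J k" for n
      using add_ideals[OF iI iJ] sum_ideal_upper[OF iI iJ]
        sum_ideal_least[OF add_ideals[OF iI iJ], of "I (Suc n)" n k "J k"]  antiI[of n "Suc n"]
      by (meson le_SucI order_refl order_trans)
    ultimately show ?thesis
      unfolding descending_stable_def by (elim allE[of _ "\<lambda>n. I n <+>\<^bsub>R\<^esub> J k"]) blast
  qed
  \<comment> \<open>From stage \<open>n\<close> on, the directions no longer shrink modulo
    \<open>J k\<close>.\<close>
  define stab where "stab k n \<longleftrightarrow> (\<forall>l\<ge>n. I n \<subseteq> I l <+>\<^bsub>R\<^esub> J k)" for k n
  have ex_stab: "\<exists>n'\<ge>n. stab k n'" for k n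
  proof -
    obtain n0 where n0: "\<And>l. l \<ge> n0 \<Longrightarrow> I l <+>\<^bsub>R\<^esub> J k = I n0 <+>\<^bsub>R\<^esub> J k" using ex_stable by blast
    have "stab k (max n n0)" unfolding stab_def
    proof (intro allI impI)
      fix l assume "max n n0 \<le> l"
      then have "I l <+>\<^bsub>R\<^esub> J k = I (max n n0) <+>\<^bsub>R\<^esub> J k" using n0[of l] n0[of "max n n0"] by simp
      then show "I (max n n0) \<subseteq> I l <+>\<^bsub>R\<^esub> J k" using sum_ideal_upper(1)[OF iI iJ] by simp
    qed
    then show ?thesis by (meson max.cobounded1)
  qed
  \<comment> \<open>At a stable stage a point can be moved into any later set with an error in
    \<open>J k\<close>: start from an arbitrary \<open>e\<close> there and add the part of
    \<open>y \<ominus> e\<close> lying in \<open>I n'\<close>.\<close>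
  have approx: "\<exists>y'\<in>C n'. y' \<ominus> y \<in> J k" if y: "y \<in> C n" and st: "stab k n" and "n \<le> n'" for y k n n'
  proof -
    obtain e where e: "e \<in> C n'" using C(2) by blast
    have "y \<ominus> e \<in> I n" using diff y e antiC[OF that(3)] by blast
    then have "y \<ominus> e \<in> I n' <+>\<^bsub>R\<^esub> J k" using st that(3) unfolding stab_def by blast
    then obtain a b where ab: "a \<in> I n'" "b \<in> J k" "y \<ominus> e = a \<oplus> b" unfolding sum_ideal_mem_iff by blast
    have c: "a \<in> carrier R" "b \<in> carrier R" "e \<in> carrier R" "y \<in> carrier R"
      using ideal.Icarr[OF iI ab(1)] ideal.Icarr[OF iJ ab(2)] car e y by blast+
    have "(e \<oplus> a) \<ominus> y = a \<ominus> (y \<ominus> e)" using c by algebra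
    also have "\<dots> = \<zero> \<ominus> b" unfolding ab(3) using c by algebra
    finally have "(e \<oplus> a) \<ominus> y \<in> J k" using ideal_minus_mem[OF iJ ideal_zero_mem[OF iJ] ab(2)] by simp
    then show ?thesis using tr[OF e ab(1)] by blast
  qed
  \<comment> \<open>Each \<open>f k\<close> is a pair of a stage, stable modulo \<open>J k\<close>,
    and a point of the set at that stage. The successive differences have exactly the form required
    by \<open>adically_complete\<close>.\<close>
  have "\<exists>f. \<forall>k. (snd (f k) \<in> C (fst (f k)) \<and> stab k (fst (f k))) \<and>
      snd (f (Suc k)) \<ominus> snd (f k) \<in> J k"
  proof (rule dependent_nat_choice)
    obtain n where "stab 0 n" using ex_stab by blast
    moreover obtain y where "y \<in> C n" using C(2) by blast
    ultimately show "\<exists>x. snd x \<in> C (fst x) \<and> stab 0 (fst x)" by (intro exI[of _ "(n, y)"]) simp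
  next
    fix x k assume x: "snd x \<in> C (fst x) \<and> stab k (fst x)"
    obtain n' where n': "fst x \<le> n'" "stab (Suc k) n'" using ex_stab by blast
    obtain y' where "y' \<in> C n'" "y' \<ominus> snd x \<in> J k" using approx x n' by blast
    then show "\<exists>z. (snd z \<in> C (fst z) \<and> stab (Suc k) (fst z)) \<and> snd z \<ominus> snd x \<in> J k"
      using n' by (intro exI[of _ "(n', y')"]) simp
  qed
  then obtain f where f: "\<And>k. snd (f k) \<in> C (fst (f k))" "\<And>k. stab k (fst (f k))"
    "\<And>k. snd (f (Suc k)) \<ominus> snd (f k) \<in> J k" by blast
  define y where "y k = snd (f k)" for k
  have yc: "y k \<in> carrier R" for k using f(1) car unfolding y_def by blast
  have "\<forall>k. y k \<in> carrier R \<and> y (Suc k) \<ominus> y k \<in> ideal_pow R (jacobson_radical R) k"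
    using yc f(3) unfolding y_def J_def by auto
  then have "\<exists>x\<in>carrier R. \<forall>k. x \<ominus> y k \<in> J k"
    using compl unfolding adically_complete_def J_def by (elim conjE allE[of _ y]) (rule mp)
  then obtain x where x: "x \<in> carrier R" "\<And>k. x \<ominus> y k \<in> J k" by blast
  have "x \<in> C n" for n
  proof -
    obtain c where c: "c \<in> C n" using C(2) by blast
    have cc: "c \<in> carrier R" using car[OF c] .
    \<comment> \<open>Since \<open>C n\<close> is the coset of \<open>I n\<close> through
      \<open>c\<close>, membership of the limit means \<open>x \<ominus> c\<close> in
      \<open>I n\<close>. By Krull's theorem it suffices to check this modulo every
      \<open>J k\<close>.\<close>
    have "x \<ominus> c \<in> I n <+>\<^bsub>R\<^esub> J k" for k
    proof -
      \<comment> \<open>A point of \<open>C n\<close> congruent to \<open>y k\<close>: by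
        approximation if the stage of \<open>y k\<close> is at most \<open>n\<close>, and otherwise
        \<open>y k\<close> itself.\<close>
      obtain y' where y': "y' \<in> C n" "y' \<ominus> y k \<in> J k"
      proof (cases "fst (f k) \<le> n")
        case True then show ?thesis using approx[OF f(1,2) True] that unfolding y_def by blast
      next
        case False
        then have "y k \<in> C n" using f(1)[of k] antiC[of n "fst (f k)"] unfolding y_def by auto
        moreover have "y k \<ominus> y k \<in> J k" using yc ideal_zero_mem[OF iJ] by (simp add: r_neg a_minus_def)
        ultimately show ?thesis using that by blast
      qed
      have "x \<ominus> c = (y' \<ominus> c) \<oplus> ((x \<ominus> y k) \<ominus> (y' \<ominus> y k))"
        using x(1) cc yc[of k] car[OF y'(1)] by algebra
      then show ?thesis
        using diff[OF y'(1) c] ideal_minus_mem[OF iJ x(2) y'(2)] unfolding sum_ideal_mem_iff by blast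
    qed
    then have "x \<ominus> c \<in> I n" using krull_intersection[OF sl iI] unfolding J_def by blast
    then have "c \<oplus> (x \<ominus> c) \<in> C n" by (rule tr[OF c])
    moreover have "c \<oplus> (x \<ominus> c) = x" using x(1) cc by algebra
    ultimately show ?thesis by simp
  qed
  then show ?thesis using x(1) by blast
qed

end

section \<open>Affine subsets and linear compactness of finitely generated modules\<close>

text \<open>This is \<open>x + r (y - z)\<close>, written without subtraction so that it visibly commutes with
  linear maps.\<close>
definition affine_comb ::
    "('r, 'x) ring_scheme \<Rightarrow> ('r, 'm, 'y) module_scheme \<Rightarrow> 'r \<Rightarrow> 'm \<Rightarrow> 'm \<Rightarrow> 'm \<Rightarrow> 'm" where
  "affine_comb R M r x y z = x \<oplus>\<^bsub>M\<^esub> (r \<odot>\<^bsub>M\<^esub> y \<oplus>\<^bsub>M\<^esub> (\<ominus>\<^bsub>R\<^esub> r) \<odot>\<^bsub>M\<^esub> z)"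

text \<open>These sets are the cosets of submodules together with the empty set.\<close>

definition affine_closed :: "('r, 'x) ring_scheme \<Rightarrow> ('r, 'm, 'y) module_scheme \<Rightarrow> 'm set \<Rightarrow> bool" where
  "affine_closed R M C \<longleftrightarrow> C \<subseteq> carrier M \<and>
     (\<forall>x\<in>C. \<forall>y\<in>C. \<forall>z\<in>C. \<forall>r\<in>carrier R. affine_comb R M r x y z \<in> C)"

lemma (in module) affine_comb_closed:
  "x \<in> carrier M \<Longrightarrow> y \<in> carrier M \<Longrightarrow> z \<in> carrier M \<Longrightarrow> r \<in> carrier R \<Longrightarrow>
    affine_comb R M r x y z \<in> carrier M"
  by (simp add: affine_comb_def)

lemma (in module) affine_comb_same:
  assumes "x \<in> carrier M" "r \<in> carrier R"
  shows "affine_comb R M r x x x = x"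
proof -
  have "r \<odot>\<^bsub>M\<^esub> x \<oplus>\<^bsub>M\<^esub> (\<ominus> r) \<odot>\<^bsub>M\<^esub> x = \<zero>\<^bsub>M\<^esub>"
    using assms by (simp add: smult_l_distr[symmetric] R.r_neg)
  then show ?thesis using assms by (simp add: affine_comb_def)
qed

text \<open>Combining elements \<open>u + r a\<close> acts separately on the part \<open>u\<close>
  and on the coefficient, where it is the affine combination of the ring itself. This lets
  coefficients be treated by \<open>ring_linearly_compact\<close>.\<close>

lemma (in module) affine_comb_split:
  assumes "u \<in> carrier M" "v \<in> carrier M" "w \<in> carrier M" "a \<in> carrier M"
    and "r \<in> carrier R" "s \<in> carrier R" "t \<in> carrier R" "c \<in> carrier R"
  shows "affine_comb R M c (u \<oplus>\<^bsub>M\<^esub> r \<odot>\<^bsub>M\<^esub> a) (v \<oplus>\<^bsub>M\<^esub> s \<odot>\<^bsub>M\<^esub> a) (w \<oplus>\<^bsub>M\<^esub> t \<odot>\<^bsub>M\<^esub> a)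
    = affine_comb R M c u v w \<oplus>\<^bsub>M\<^esub> (r \<oplus> (c \<otimes> s \<oplus> (\<ominus> c) \<otimes> t)) \<odot>\<^bsub>M\<^esub> a"
  using assms by (simp add: affine_comb_def smult_r_distr smult_l_distr smult_assoc1 M.a_ac)

lemma module_hom_affine_comb:
  assumes "module R A" "module R B" "module_hom R A B f"
    and "x \<in> carrier A" "y \<in> carrier A" "z \<in> carrier A" "r \<in> carrier R"
  shows "f (affine_comb R A r x y z) = affine_comb R B r (f x) (f y) (f z)"
proof -
  interpret A: module R A by fact
  interpret B: module R B by fact
  show ?thesis using assms(3-) unfolding module_hom_def affine_comb_def by simp
qed

lemma module_hom_zero:
  assumes "module R A" "module R B" "module_hom R A B f"
  shows "f \<zero>\<^bsub>A\<^esub> = \<zero>\<^bsub>B\<^esub>"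
proof -
  interpret A: module R A by fact
  interpret B: module R B by fact
  have "f (\<zero>\<^bsub>R\<^esub> \<odot>\<^bsub>A\<^esub> \<zero>\<^bsub>A\<^esub>) = \<zero>\<^bsub>R\<^esub> \<odot>\<^bsub>B\<^esub> f \<zero>\<^bsub>A\<^esub>"
    using assms(3) A.R.zero_closed A.M.zero_closed unfolding module_hom_def by blast
  moreover have "f \<zero>\<^bsub>A\<^esub> \<in> carrier B" using assms(3) A.M.zero_closed unfolding module_hom_def by blast
  ultimately show ?thesis by simp
qed

text \<open>The notion is attached to a subset \<open>U\<close> so that the induction on generators
  can pass through partial spans. Sequences of sets suffice because chains along a ray are truncated
  at natural numbers.\<close>

definition linearly_compact :: "('r, 'x) ring_scheme \<Rightarrow> ('r, 'm, 'y) module_scheme \<Rightarrow> 'm set \<Rightarrow> bool" where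
  "linearly_compact R M U \<longleftrightarrow> affine_closed R M U \<and>
     (\<forall>C :: nat \<Rightarrow> 'm set. (\<forall>n. affine_closed R M (C n) \<and> C n \<noteq> {} \<and> C (Suc n) \<subseteq> C n \<and> C n \<subseteq> U)
       \<longrightarrow> (\<exists>x. \<forall>n. x \<in> C n))"

lemma linearly_compact_zero:
  assumes "module R M"
  shows "linearly_compact R M {\<zero>\<^bsub>M\<^esub>}"
proof -
  interpret module R M by fact
  show ?thesis
    unfolding linearly_compact_def
  proof (intro conjI allI impI)
    show "affine_closed R M {\<zero>\<^bsub>M\<^esub>}" by (auto simp: affine_closed_def affine_comb_same)
    fix C assume "\<forall>n. affine_closed R M (C n) \<and> C n \<noteq> {} \<and> C (Suc n) \<subseteq> C n \<and> C n \<subseteq> {\<zero>\<^bsub>M\<^esub>}"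
    then have "\<zero>\<^bsub>M\<^esub> \<in> C n" for n by blast
    then show "\<exists>x. \<forall>n. x \<in> C n" by blast
  qed
qed

text \<open>The two components are chosen one after the other: first a coefficient of
  \<open>a\<close> that occurs in every \<open>C n\<close>, by linear compactness of the ring, then
  an element of \<open>U\<close> that works with this fixed coefficient for all \<open>n\<close>.
  The sum need not be direct.\<close>

lemma linearly_compact_adjoin:
  fixes M :: "('r, 'm, 'y) module_scheme"
  assumes "noetherian_cring R" and sl: "semilocal R" and compl: "adically_complete R (jacobson_radical R)"
    and "module R M" and U: "linearly_compact R M U" and a: "a \<in> carrier M"
  shows "linearly_compact R M {u \<oplus>\<^bsub>M\<^esub> r \<odot>\<^bsub>M\<^esub> a | u r. u \<in> U \<and> r \<in> carrier R}"
    (is "linearly_compact R M ?V")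
proof -
  interpret noetherian_cring R by fact
  interpret M: module R M by fact
  have UM: "u \<in> carrier M" if "u \<in> U" for u
    using U that unfolding linearly_compact_def affine_closed_def by blast
  have affU: "affine_comb R M c u v w \<in> U" if "u \<in> U" "v \<in> U" "w \<in> U" "c \<in> carrier R" for u v w c
    using U that unfolding linearly_compact_def affine_closed_def by blast
  have "affine_closed R M ?V"
    unfolding affine_closed_def
  proof (intro conjI ballI)
    show "?V \<subseteq> carrier M" using UM a by auto
    fix x y z c assume xyz: "x \<in> ?V" "y \<in> ?V" "z \<in> ?V" and c: "c \<in> carrier R"
    obtain u r where ur: "u \<in> U" "r \<in> carrier R" "x = u \<oplus>\<^bsub>M\<^esub> r \<odot>\<^bsub>M\<^esub> a" using xyz(1) by blast
    obtain v s where vs: "v \<in> U" "s \<in> carrier R" "y = v \<oplus>\<^bsub>M\<^esub> s \<odot>\<^bsub>M\<^esub> a" using xyz(2) by blast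
    obtain w t where wt: "w \<in> U" "t \<in> carrier R" "z = w \<oplus>\<^bsub>M\<^esub> t \<odot>\<^bsub>M\<^esub> a" using xyz(3) by blast
    have "affine_comb R M c x y z
        = affine_comb R M c u v w \<oplus>\<^bsub>M\<^esub> (r \<oplus>\<^bsub>R\<^esub> (c \<otimes>\<^bsub>R\<^esub> s \<oplus>\<^bsub>R\<^esub> (\<ominus>\<^bsub>R\<^esub> c) \<otimes>\<^bsub>R\<^esub> t)) \<odot>\<^bsub>M\<^esub> a"
      unfolding ur(3) vs(3) wt(3) using ur vs wt c a UM by (intro M.affine_comb_split) auto
    moreover have "r \<oplus>\<^bsub>R\<^esub> (c \<otimes>\<^bsub>R\<^esub> s \<oplus>\<^bsub>R\<^esub> (\<ominus>\<^bsub>R\<^esub> c) \<otimes>\<^bsub>R\<^esub> t) \<in> carrier R" using ur vs wt c by simp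
    ultimately show "affine_comb R M c x y z \<in> ?V" using affU[OF ur(1) vs(1) wt(1) c] by blast
  qed
  moreover have "\<exists>x. \<forall>n. x \<in> C n"
    if C: "\<forall>n. affine_closed R M (C n) \<and> C n \<noteq> {} \<and> C (Suc n) \<subseteq> C n \<and> C n \<subseteq> ?V" for C :: "nat \<Rightarrow> 'm set"
  proof -
    have aff: "affine_comb R M c x y z \<in> C n"
      if "x \<in> C n" "y \<in> C n" "z \<in> C n" "c \<in> carrier R" for x y z c n
      using C that unfolding affine_closed_def by blast
    \<comment> \<open>All coefficients of \<open>a\<close> occurring in some representation of an
      element of \<open>C n\<close>.\<close>
    define D where "D n = {r \<in> carrier R. \<exists>u\<in>U. u \<oplus>\<^bsub>M\<^esub> r \<odot>\<^bsub>M\<^esub> a \<in> C n}" for n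
    have "\<exists>r\<in>carrier R. \<forall>n. r \<in> D n"
    proof (rule ring_linearly_compact[OF sl compl])
      show "D n \<subseteq> carrier R" for n unfolding D_def by blast
      show "D n \<noteq> {}" for n
      proof -
        obtain x where x: "x \<in> C n" using C by blast
        then have "x \<in> ?V" using C by blast
        then show ?thesis using x unfolding D_def by blast
      qed
      show "D (Suc n) \<subseteq> D n" for n using C unfolding D_def by blast
      fix n r s t c assume rst: "r \<in> D n" "s \<in> D n" "t \<in> D n" and c: "c \<in> carrier R"
      obtain u where u: "u \<in> U" "r \<in> carrier R" "u \<oplus>\<^bsub>M\<^esub> r \<odot>\<^bsub>M\<^esub> a \<in> C n" using rst(1) unfolding D_def by blast
      obtain v where v: "v \<in> U" "s \<in> carrier R" "v \<oplus>\<^bsub>M\<^esub> s \<odot>\<^bsub>M\<^esub> a \<in> C n" using rst(2) unfolding D_def by blast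
      obtain w where w: "w \<in> U" "t \<in> carrier R" "w \<oplus>\<^bsub>M\<^esub> t \<odot>\<^bsub>M\<^esub> a \<in> C n" using rst(3) unfolding D_def by blast
      have "affine_comb R M c u v w \<oplus>\<^bsub>M\<^esub> (r \<oplus>\<^bsub>R\<^esub> (c \<otimes>\<^bsub>R\<^esub> s \<oplus>\<^bsub>R\<^esub> (\<ominus>\<^bsub>R\<^esub> c) \<otimes>\<^bsub>R\<^esub> t)) \<odot>\<^bsub>M\<^esub> a \<in> C n"
        using aff[OF u(3) v(3) w(3) c] M.affine_comb_split[of u v w a r s t c] u v w c a UM by simp
      moreover have "r \<oplus>\<^bsub>R\<^esub> (c \<otimes>\<^bsub>R\<^esub> s \<oplus>\<^bsub>R\<^esub> (\<ominus>\<^bsub>R\<^esub> c) \<otimes>\<^bsub>R\<^esub> t) \<in> carrier R" using u v w c by simp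
      ultimately show "r \<oplus>\<^bsub>R\<^esub> (c \<otimes>\<^bsub>R\<^esub> s \<oplus>\<^bsub>R\<^esub> (\<ominus>\<^bsub>R\<^esub> c) \<otimes>\<^bsub>R\<^esub> t) \<in> D n"
        using affU[OF u(1) v(1) w(1) c] unfolding D_def by blast
    qed
    then obtain r where r: "r \<in> carrier R" "\<And>n. r \<in> D n" by blast
    \<comment> \<open>The fibre of \<open>C n\<close> over the chosen coefficient \<open>r\<close>;
      it is nonempty because \<open>r\<close> lies in \<open>D n\<close>.\<close>
    define E where "E n = {u \<in> U. u \<oplus>\<^bsub>M\<^esub> r \<odot>\<^bsub>M\<^esub> a \<in> C n}" for n
    have "affine_closed R M (E n)" for n
      unfolding affine_closed_def
    proof (intro conjI ballI)
      show "E n \<subseteq> carrier M" using UM unfolding E_def by blast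
      fix u v w c assume uvw: "u \<in> E n" "v \<in> E n" "w \<in> E n" and c: "c \<in> carrier R"
      then have uvw': "u \<in> U" "v \<in> U" "w \<in> U" unfolding E_def by auto
      \<comment> \<open>Hence the affine combination of three copies of \<open>r\<close> is
        \<open>r\<close>, and the combination stays in the same fibre.\<close>
      have "c \<otimes>\<^bsub>R\<^esub> r \<oplus>\<^bsub>R\<^esub> (\<ominus>\<^bsub>R\<^esub> c) \<otimes>\<^bsub>R\<^esub> r = \<zero>\<^bsub>R\<^esub>" using c r(1) by algebra
      then have "affine_comb R M c u v w \<oplus>\<^bsub>M\<^esub> r \<odot>\<^bsub>M\<^esub> a \<in> C n"
        using aff[of "u \<oplus>\<^bsub>M\<^esub> r \<odot>\<^bsub>M\<^esub> a" n "v \<oplus>\<^bsub>M\<^esub> r \<odot>\<^bsub>M\<^esub> a" "w \<oplus>\<^bsub>M\<^esub> r \<odot>\<^bsub>M\<^esub> a" c]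
          M.affine_comb_split[of u v w a r r r c] uvw c a r(1) UM unfolding E_def by simp
      then show "affine_comb R M c u v w \<in> E n" using affU[OF uvw' c] unfolding E_def by blast
    qed
    moreover have "E n \<noteq> {}" "E (Suc n) \<subseteq> E n" "E n \<subseteq> U" for n
      using r(2)[of n] C unfolding D_def E_def by blast+
    ultimately obtain u where "\<forall>n. u \<in> E n"
      using U unfolding linearly_compact_def by blast
    then show ?thesis unfolding E_def by blast
  qed
  ultimately show ?thesis unfolding linearly_compact_def by blast
qed

lemma fin_gen_module_linearly_compact:
  assumes "noetherian_cring R" "semilocal R" "adically_complete R (jacobson_radical R)"
    and "module R M" "fin_gen_module R M"
  shows "linearly_compact R M (carrier M)"
proof -
  interpret noetherian_cring R by fact
  interpret M: module R M by fact
  \<comment> \<open>It is enough that \<open>U\<close> contains all linear combinations of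
    \<open>A\<close>; the reverse inclusion into the carrier comes from affine closedness.\<close>
  have span: "\<exists>U. linearly_compact R M U \<and> (\<forall>c\<in>A \<rightarrow> carrier R. finsum M (\<lambda>a. c a \<odot>\<^bsub>M\<^esub> a) A \<in> U)"
    if "finite A" "A \<subseteq> carrier M" for A
    using that
  proof (induction A rule: finite_induct)
    case empty
    then show ?case using linearly_compact_zero[OF assms(4)] by (intro exI[of _ "{\<zero>\<^bsub>M\<^esub>}"]) simp
  next
    case (insert a A)
    then obtain U where U: "linearly_compact R M U"
      "\<forall>c\<in>A \<rightarrow> carrier R. finsum M (\<lambda>a. c a \<odot>\<^bsub>M\<^esub> a) A \<in> U" by auto
    have a: "a \<in> carrier M" and A: "A \<subseteq> carrier M" using insert.prems by auto
    let ?V = "{u \<oplus>\<^bsub>M\<^esub> r \<odot>\<^bsub>M\<^esub> a | u r. u \<in> U \<and> r \<in> carrier R}"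
    have "finsum M (\<lambda>a. c a \<odot>\<^bsub>M\<^esub> a) (insert a A) \<in> ?V" if c: "c \<in> insert a A \<rightarrow> carrier R" for c
    proof -
      have ca: "c a \<in> carrier R" and cA: "c \<in> A \<rightarrow> carrier R" using c by auto
      have "finsum M (\<lambda>a. c a \<odot>\<^bsub>M\<^esub> a) A \<in> carrier M"
        using cA A by (intro M.finsum_closed) auto
      moreover have "finsum M (\<lambda>a. c a \<odot>\<^bsub>M\<^esub> a) (insert a A) = c a \<odot>\<^bsub>M\<^esub> a \<oplus>\<^bsub>M\<^esub> finsum M (\<lambda>a. c a \<odot>\<^bsub>M\<^esub> a) A"
        using insert.hyps cA ca a A by (intro M.finsum_insert) auto
      ultimately have "finsum M (\<lambda>a. c a \<odot>\<^bsub>M\<^esub> a) (insert a A) = finsum M (\<lambda>a. c a \<odot>\<^bsub>M\<^esub> a) A \<oplus>\<^bsub>M\<^esub> c a \<odot>\<^bsub>M\<^esub> a"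
        using ca a by (simp add: M.a_comm)
      then show ?thesis using U(2) cA ca by blast
    qed
    then show ?case using linearly_compact_adjoin[OF assms(1-4) U(1) a] by blast
  qed
  obtain A where A: "finite A" "A \<subseteq> carrier M"
      "carrier M = {finsum M (\<lambda>a. c a \<odot>\<^bsub>M\<^esub> a) A | c. c \<in> A \<rightarrow> carrier R}"
    using assms(5) unfolding fin_gen_module_def by blast
  obtain U where U: "linearly_compact R M U" "\<forall>c\<in>A \<rightarrow> carrier R. finsum M (\<lambda>a. c a \<odot>\<^bsub>M\<^esub> a) A \<in> U"
    using span[OF A(1,2)] by blast
  have "carrier M \<subseteq> U" unfolding A(3) using U(2) by blast
  moreover have "U \<subseteq> carrier M" using U(1) unfolding linearly_compact_def affine_closed_def by blast
  ultimately show ?thesis using U(1) by simp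
qed

section \<open>Chains along a ray\<close>

lemma ray_vertex_Suc: "ray_vertex s (Suc i) = ray_vertex s i @ [s i]"
  by (simp add: ray_vertex_def)

lemma ray_vertex_cong: "(\<And>i. i < n \<Longrightarrow> s i = t i) \<Longrightarrow> ray_vertex s n = ray_vertex t n"
  by (simp add: ray_vertex_def)

lemma mu_rel_Suc:
  "mu_rel Md Om Mh s (Suc i) =
     (if s i then {(Om (ray_vertex s i) y, y) | y. y \<in> carrier (Md (ray_vertex s i))}
      else {(x, Mh (ray_vertex s i) x) | x. x \<in> carrier (Md (ray_vertex s i @ [False]))})"
  by (auto simp: mu_rel_def ray_vertex_Suc)

text \<open>Reindexing by successors removes the truncated subtraction \<open>i - 1\<close>.\<close>

lemma mu_le_iff:
  "m \<in> mu_le Md Om Mh s n S \<longleftrightarrow> (\<exists>f. f 0 = m \<and> f n \<in> S \<and>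
     (\<forall>i\<le>n. f i \<in> carrier (Md (ray_vertex s i))) \<and> (\<forall>i<n. (f (Suc i), f i) \<in> mu_rel Md Om Mh s (Suc i)))"
proof -
  have "(\<forall>i\<in>{1..n}. (f i, f (i - 1)) \<in> mu_rel Md Om Mh s i) \<longleftrightarrow>
      (\<forall>i<n. (f (Suc i), f i) \<in> mu_rel Md Om Mh s (Suc i))" for f
  proof (intro iffI ballI allI impI)
    show "(f i, f (i - 1)) \<in> mu_rel Md Om Mh s i"
      if "\<forall>i<n. (f (Suc i), f i) \<in> mu_rel Md Om Mh s (Suc i)" "i \<in> {1..n}" for i
      using that by (cases i) auto
    show "(f (Suc i), f i) \<in> mu_rel Md Om Mh s (Suc i)"
      if "\<forall>i\<in>{1..n}. (f i, f (i - 1)) \<in> mu_rel Md Om Mh s i" "i < n" for i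
      using bspec[OF that(1), of "Suc i"] that(2) by simp
  qed
  then show ?thesis by (simp add: mu_le_def)
qed

text \<open>This allows a condition at a vertex to be evaluated before the rest of the ray is known,
  with any sequence extending that vertex.\<close>

lemma mu_le_cong:
  assumes "\<And>i. i < n \<Longrightarrow> s i = t i"
  shows "mu_le Md Om Mh s n S = mu_le Md Om Mh t n S"
proof -
  have v: "ray_vertex s i = ray_vertex t i" if "i \<le> n" for i
    using assms that by (intro ray_vertex_cong) simp
  then have "mu_rel Md Om Mh s (Suc i) = mu_rel Md Om Mh t (Suc i)" if "i < n" for i
    using assms that by (simp add: mu_rel_Suc)
  then show ?thesis using v by (auto simp: mu_le_iff)
qed

lemma mu_le_mono:
  assumes "S \<inter> carrier (Md (ray_vertex s n)) \<subseteq> S'"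
  shows "mu_le Md Om Mh s n S \<subseteq> mu_le Md Om Mh s n S'"
proof
  fix m assume "m \<in> mu_le Md Om Mh s n S"
  then obtain f where "f 0 = m" "f n \<in> S" "\<forall>i\<le>n. f i \<in> carrier (Md (ray_vertex s i))"
    "\<forall>i<n. (f (Suc i), f i) \<in> mu_rel Md Om Mh s (Suc i)"
    unfolding mu_le_iff by blast
  then show "m \<in> mu_le Md Om Mh s n S'"
    unfolding mu_le_iff using assms by (intro exI[of _ f]) auto
qed

text \<open>The last relation of a chain is absorbed into the target set, reducing level
  \<open>Suc n\<close> to level \<open>n\<close> along the same ray.\<close>

lemma mu_le_Suc:
  "mu_le Md Om Mh s (Suc n) S = mu_le Md Om Mh s n
     {y. \<exists>x\<in>S \<inter> carrier (Md (ray_vertex s (Suc n))). (x, y) \<in> mu_rel Md Om Mh s (Suc n)}"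
  (is "_ = mu_le Md Om Mh s n ?S")
proof (intro equalityI subsetI)
  fix m assume "m \<in> mu_le Md Om Mh s (Suc n) S"
  then obtain f where "f 0 = m" "f (Suc n) \<in> S" "\<forall>i\<le>Suc n. f i \<in> carrier (Md (ray_vertex s i))"
    "\<forall>i<Suc n. (f (Suc i), f i) \<in> mu_rel Md Om Mh s (Suc i)"
    unfolding mu_le_iff by blast
  then show "m \<in> mu_le Md Om Mh s n ?S" unfolding mu_le_iff by (intro exI[of _ f]) auto
next
  fix m assume "m \<in> mu_le Md Om Mh s n ?S"
  then obtain f x where f: "f 0 = m" "\<forall>i\<le>n. f i \<in> carrier (Md (ray_vertex s i))"
      "\<forall>i<n. (f (Suc i), f i) \<in> mu_rel Md Om Mh s (Suc i)"
    and x: "x \<in> S" "x \<in> carrier (Md (ray_vertex s (Suc n)))" "(x, f n) \<in> mu_rel Md Om Mh s (Suc n)"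
    unfolding mu_le_iff by blast
  let ?g = "f(Suc n := x)"
  have "?g 0 = m" "?g (Suc n) \<in> S" using f x by auto
  moreover have "\<forall>i\<le>Suc n. ?g i \<in> carrier (Md (ray_vertex s i))" using f x by (auto simp: le_Suc_eq)
  moreover have "\<forall>i<Suc n. (?g (Suc i), ?g i) \<in> mu_rel Md Om Mh s (Suc i)"
    using f x by (auto simp: less_Suc_eq)
  ultimately show "m \<in> mu_le Md Om Mh s (Suc n) S" unfolding mu_le_iff by blast
qed

text \<open>Recursion on vertices: \<open>v\<close> appends at each stage the symbol that
  \<open>D\<close> prescribes at the current vertex.\<close>

lemma exists_ray_following:
  obtains s where "\<And>i. s i = D (ray_vertex s i)"
proof -
  define v where "v = rec_nat [] (\<lambda>_ l. l @ [D l])"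
  define s where "s i = D (v i)" for i
  have "ray_vertex s i = v i" for i
  proof (induction i)
    case 0 show ?case by (simp add: ray_vertex_def v_def)
  next
    case (Suc i) then show ?case by (simp add: ray_vertex_Suc s_def) (simp add: v_def)
  qed
  then show ?thesis using that[of s] by (simp add: s_def)
qed

section \<open>Gluing finite chains and following the two kinds of arrows\<close>

context
  fixes R :: "('r, 'x) ring_scheme"
    and Md :: "bool list \<Rightarrow> ('r, 'm) module"
    and Om Mh :: "bool list \<Rightarrow> 'm \<Rightarrow> 'm"
  assumes diagram: "B_diagram R Md Om Mh"
begin

lemma Md_module: "module R (Md \<sigma>)"
  and Om_hom: "module_hom R (Md \<sigma>) (Md (\<sigma> @ [True])) (Om \<sigma>)"
  and Mh_hom: "module_hom R (Md (\<sigma> @ [False])) (Md \<sigma>) (Mh \<sigma>)"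
  using diagram by (auto simp: B_diagram_def)

lemma Om_closed: "x \<in> carrier (Md \<sigma>) \<Longrightarrow> Om \<sigma> x \<in> carrier (Md (\<sigma> @ [True]))"
  using Om_hom[of \<sigma>] by (auto simp: module_hom_def)

lemma Md_zero_closed: "\<zero>\<^bsub>Md \<sigma>\<^esub> \<in> carrier (Md \<sigma>)"
  by (rule abelian_monoid.zero_closed[OF abelian_group.axioms(1)[OF module.axioms(2)[OF Md_module]]])

text \<open>The relation is the graph of a linear map or the converse of one, hence a submodule of
  the product.\<close>

lemma mu_rel_affine:
  assumes "(x, x') \<in> mu_rel Md Om Mh s (Suc i)" "(y, y') \<in> mu_rel Md Om Mh s (Suc i)"
    "(z, z') \<in> mu_rel Md Om Mh s (Suc i)" and r: "r \<in> carrier R"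
  shows "(affine_comb R (Md (ray_vertex s (Suc i))) r x y z,
     affine_comb R (Md (ray_vertex s i)) r x' y' z') \<in> mu_rel Md Om Mh s (Suc i)"
proof (cases "s i")
  case True
  then show ?thesis
    using assms module_hom_affine_comb[OF Md_module Md_module Om_hom, of x' "ray_vertex s i" y' z' r]
      module.affine_comb_closed[OF Md_module, of x' "ray_vertex s i" y' z' r]
    by (auto simp: mu_rel_Suc ray_vertex_Suc)
next
  case False
  then show ?thesis
    using assms module_hom_affine_comb[OF Md_module Md_module Mh_hom, of x "ray_vertex s i" y z r]
      module.affine_comb_closed[OF Md_module, of x "ray_vertex s i @ [False]" y z r]
    by (auto simp: mu_rel_Suc ray_vertex_Suc)
qed

text \<open>The candidates for the \<open>i\<close>-th entry of a chain reaching level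
  \<open>n\<close>. For \<open>n < i\<close> both conditions are vacuous, so only indices
  \<open>n \<ge> i\<close> carry information.\<close>

definition extendable :: "(nat \<Rightarrow> bool) \<Rightarrow> nat \<Rightarrow> nat \<Rightarrow> 'm set" where
  "extendable s i n = {f i | f. (\<forall>j. i \<le> j \<and> j \<le> n \<longrightarrow> f j \<in> carrier (Md (ray_vertex s j))) \<and>
     (\<forall>j. i \<le> j \<and> j < n \<longrightarrow> (f (Suc j), f j) \<in> mu_rel Md Om Mh s (Suc j))}"

lemma extendable_carrier: "x \<in> extendable s i n \<Longrightarrow> i \<le> n \<Longrightarrow> x \<in> carrier (Md (ray_vertex s i))"
  by (auto simp: extendable_def)

lemma extendable_antimono:
  assumes "n \<le> n'"
  shows "extendable s i n' \<subseteq> extendable s i n"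
proof
  fix x assume "x \<in> extendable s i n'"
  then obtain f where "x = f i" "\<forall>j. i \<le> j \<and> j \<le> n' \<longrightarrow> f j \<in> carrier (Md (ray_vertex s j))"
    "\<forall>j. i \<le> j \<and> j < n' \<longrightarrow> (f (Suc j), f j) \<in> mu_rel Md Om Mh s (Suc j)"
    unfolding extendable_def by blast
  then show "x \<in> extendable s i n"
    unfolding extendable_def using assms by (intro CollectI exI[of _ f]) auto
qed

lemma extendable_step:
  assumes "x \<in> extendable s i n" "i < n"
  obtains y where "y \<in> extendable s (Suc i) n" "(y, x) \<in> mu_rel Md Om Mh s (Suc i)"
proof -
  obtain f where f: "x = f i" "\<And>j. i \<le> j \<and> j \<le> n \<Longrightarrow> f j \<in> carrier (Md (ray_vertex s j))"
    "\<And>j. i \<le> j \<and> j < n \<Longrightarrow> (f (Suc j), f j) \<in> mu_rel Md Om Mh s (Suc j)"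
    using assms(1) unfolding extendable_def by blast
  then have "f (Suc i) \<in> extendable s (Suc i) n"
    unfolding extendable_def using Suc_leD by blast
  then show ?thesis using that f(3)[of i] f(1) assms(2) by auto
qed

lemma extendable_affine:
  assumes "x \<in> extendable s i n" "y \<in> extendable s i n" "z \<in> extendable s i n" and r: "r \<in> carrier R"
  shows "affine_comb R (Md (ray_vertex s i)) r x y z \<in> extendable s i n"
proof -
  obtain f where f: "x = f i" "\<And>j. i \<le> j \<and> j \<le> n \<Longrightarrow> f j \<in> carrier (Md (ray_vertex s j))"
    "\<And>j. i \<le> j \<and> j < n \<Longrightarrow> (f (Suc j), f j) \<in> mu_rel Md Om Mh s (Suc j)"
    using assms(1) unfolding extendable_def by blast
  obtain g where g: "y = g i" "\<And>j. i \<le> j \<and> j \<le> n \<Longrightarrow> g j \<in> carrier (Md (ray_vertex s j))"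
    "\<And>j. i \<le> j \<and> j < n \<Longrightarrow> (g (Suc j), g j) \<in> mu_rel Md Om Mh s (Suc j)"
    using assms(2) unfolding extendable_def by blast
  obtain h where h: "z = h i" "\<And>j. i \<le> j \<and> j \<le> n \<Longrightarrow> h j \<in> carrier (Md (ray_vertex s j))"
    "\<And>j. i \<le> j \<and> j < n \<Longrightarrow> (h (Suc j), h j) \<in> mu_rel Md Om Mh s (Suc j)"
    using assms(3) unfolding extendable_def by blast
  let ?k = "\<lambda>j. affine_comb R (Md (ray_vertex s j)) r (f j) (g j) (h j)"
  have "?k j \<in> carrier (Md (ray_vertex s j))" if "i \<le> j \<and> j \<le> n" for j
    by (rule module.affine_comb_closed[OF Md_module f(2)[OF that] g(2)[OF that] h(2)[OF that] r])
  moreover have "(?k (Suc j), ?k j) \<in> mu_rel Md Om Mh s (Suc j)" if "i \<le> j \<and> j < n" for j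
    by (rule mu_rel_affine[OF f(3)[OF that] g(3)[OF that] h(3)[OF that] r])
  ultimately show ?thesis
    unfolding f(1) g(1) h(1) extendable_def by (intro CollectI exI[of _ ?k]) simp
qed

text \<open>Entries are chosen one at a time under the invariant that each can be continued to every
  finite level. The admissible successors for the various levels form a decreasing sequence of
  nonempty affine sets, and linear compactness gives one good for all levels.\<close>

lemma exists_infinite_chain:
  assumes lc: "\<And>\<sigma>. linearly_compact R (Md \<sigma>) (carrier (Md \<sigma>))"
    and fin: "\<And>n. m \<in> mu_le Md Om Mh s n (carrier (Md (ray_vertex s n)))"
  shows "\<exists>mm. mm 0 = m \<and> (\<forall>i. mm i \<in> carrier (Md (ray_vertex s i))) \<and>
     (\<forall>i>0. (mm i, mm (i - 1)) \<in> mu_rel Md Om Mh s i)"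
proof -
  have "\<exists>f. \<forall>i. ((i = 0 \<longrightarrow> f i = m) \<and> (\<forall>n\<ge>i. f i \<in> extendable s i n)) \<and>
      (f (Suc i), f i) \<in> mu_rel Md Om Mh s (Suc i)"
  proof (rule dependent_nat_choice)
    have "m \<in> extendable s 0 n" for n using fin[of n] unfolding mu_le_iff extendable_def by auto
    then show "\<exists>x. (0 = (0::nat) \<longrightarrow> x = m) \<and> (\<forall>n\<ge>0. x \<in> extendable s 0 n)" by blast
  next
    fix x i assume "(i = 0 \<longrightarrow> x = m) \<and> (\<forall>n\<ge>i. x \<in> extendable s i n)"
    then have x: "\<And>n. n \<ge> i \<Longrightarrow> x \<in> extendable s i n" by blast
    have xc: "x \<in> carrier (Md (ray_vertex s i))" using x[of i] extendable_carrier by blast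
    \<comment> \<open>Successors of \<open>x\<close> that can be continued \<open>n\<close> steps
      further; starting the levels at \<open>Suc i\<close> keeps \<open>extendable\<close>
      informative.\<close>
    define D where "D n = {y \<in> extendable s (Suc i) (Suc i + n). (y, x) \<in> mu_rel Md Om Mh s (Suc i)}" for n
    have Dc: "D n \<subseteq> carrier (Md (ray_vertex s (Suc i)))" for n
      using extendable_carrier unfolding D_def by auto
    have "affine_closed R (Md (ray_vertex s (Suc i))) (D n)" for n
      unfolding affine_closed_def
    proof (intro conjI ballI Dc)
      fix u v w r assume uvw: "u \<in> D n" "v \<in> D n" "w \<in> D n" and r: "r \<in> carrier R"
      \<comment> \<open>All three successors are related to the same \<open>x\<close>, and the
        affine combination of \<open>x\<close> with itself is \<open>x\<close>.\<close>
      show "affine_comb R (Md (ray_vertex s (Suc i))) r u v w \<in> D n"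
        using uvw r extendable_affine[of u s "Suc i" "Suc i + n" v w r] mu_rel_affine[of u x s i v x w x r]
          module.affine_comb_same[OF Md_module xc r] unfolding D_def by auto
    qed
    moreover have "D n \<noteq> {}" for n
      using extendable_step[OF x[of "Suc i + n"]] unfolding D_def by force
    moreover have "D (Suc n) \<subseteq> D n" for n
      using extendable_antimono[of "Suc i + n" "Suc i + Suc n" s "Suc i"] unfolding D_def by auto
    ultimately obtain y where y: "\<And>n. y \<in> D n"
      using lc[of "ray_vertex s (Suc i)"] Dc unfolding linearly_compact_def by blast
    have "y \<in> extendable s (Suc i) n" if "n \<ge> Suc i" for n
      using y[of "n - Suc i"] that unfolding D_def by simp
    moreover have "(y, x) \<in> mu_rel Md Om Mh s (Suc i)" using y[of 0] unfolding D_def by blast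
    ultimately show "\<exists>y. ((Suc i = 0 \<longrightarrow> y = m) \<and> (\<forall>n\<ge>Suc i. y \<in> extendable s (Suc i) n)) \<and>
        (y, x) \<in> mu_rel Md Om Mh s (Suc i)" by blast
  qed
  then obtain f where f: "f 0 = m" "\<And>i n. n \<ge> i \<Longrightarrow> f i \<in> extendable s i n"
    "\<And>i. (f (Suc i), f i) \<in> mu_rel Md Om Mh s (Suc i)" by blast
  have "f i \<in> carrier (Md (ray_vertex s i))" for i using f(2)[of i i] extendable_carrier by blast
  moreover have "(f i, f (i - 1)) \<in> mu_rel Md Om Mh s i" if "i > 0" for i
    using f(3)[of "i - 1"] that by simp
  ultimately show ?thesis using f(1) by blast
qed

text \<open>A map \<Omega> can be applied to every element, so reaching level \<open>n\<close> is
  the same as reaching the next level; its value is zero precisely on the kernel.\<close>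

lemma mu_le_Suc_True:
  assumes "s n"
  shows "mu_le Md Om Mh s (Suc n) (carrier (Md (ray_vertex s (Suc n)))) =
      mu_le Md Om Mh s n (carrier (Md (ray_vertex s n)))" (is ?car)
    and "mu_le Md Om Mh s (Suc n) {\<zero>\<^bsub>Md (ray_vertex s (Suc n))\<^esub>} =
      mu_le Md Om Mh s n (hom_ker (Md (ray_vertex s n)) (Md (ray_vertex s n @ [True])) (Om (ray_vertex s n)))"
      (is ?ker)
proof -
  show ?car unfolding mu_le_Suc using assms Om_closed
    by (intro equalityI mu_le_mono) (auto simp: mu_rel_Suc ray_vertex_Suc)
  show ?ker unfolding mu_le_Suc hom_ker_def using assms Md_zero_closed[of "ray_vertex s n @ [True]"]
    by (intro equalityI mu_le_mono) (auto simp: mu_rel_Suc ray_vertex_Suc)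
qed

text \<open>A map \<mho> runs backwards: a chain can be continued only from its image, and a chain
  ending in zero has zero one level earlier too.\<close>

lemma mu_le_Suc_False:
  assumes "\<not> s n"
  shows "mu_le Md Om Mh s (Suc n) (carrier (Md (ray_vertex s (Suc n)))) =
      mu_le Md Om Mh s n (hom_im (Md (ray_vertex s n @ [False])) (Mh (ray_vertex s n)))" (is ?im)
    and "mu_le Md Om Mh s (Suc n) {\<zero>\<^bsub>Md (ray_vertex s (Suc n))\<^esub>} \<subseteq>
      mu_le Md Om Mh s n {\<zero>\<^bsub>Md (ray_vertex s n)\<^esub>}" (is ?zero)
proof -
  show ?im unfolding mu_le_Suc hom_im_def using assms
    by (intro equalityI mu_le_mono) (auto simp: mu_rel_Suc ray_vertex_Suc)
  show ?zero unfolding mu_le_Suc using assms module_hom_zero[OF Md_module Md_module Mh_hom]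
    by (intro mu_le_mono) (auto simp: mu_rel_Suc ray_vertex_Suc)
qed

end

section \<open>The greedy ray and its two alternatives\<close>

theorem theorem5p17:
  fixes R :: "'r ring"
    and Md :: "bool list \<Rightarrow> ('r, 'm) module"
    and Om Mh :: "bool list \<Rightarrow> 'm \<Rightarrow> 'm"
    and m :: 'm
  assumes "cring R"
    and "noetherian_ring R"
    and "semilocal R"
    and "adically_complete R (jacobson_radical R)"
    and "B_diagram R Md Om Mh"
    and "\<And>\<sigma>. fin_gen_module R (Md \<sigma>)"
    and "\<And>\<sigma>. hom_im (Md (\<sigma> @ [False])) (Mh \<sigma>) \<subseteq> hom_ker (Md \<sigma>) (Md (\<sigma> @ [True])) (Om \<sigma>)"
    and "m \<in> carrier (Md [])"
    and "m \<noteq> \<zero>\<^bsub>Md []\<^esub>"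
  shows "\<exists>s :: nat \<Rightarrow> bool.
     (\<exists>j. m \<in> mu_le Md Om Mh s j
                 (hom_ker (Md (ray_vertex s j)) (Md (ray_vertex s j @ [True])) (Om (ray_vertex s j)))
          \<and> m \<notin> mu_le Md Om Mh s j
                 (hom_im (Md (ray_vertex s j @ [False])) (Mh (ray_vertex s j))))
     \<noteq>
     ((\<exists>mm :: nat \<Rightarrow> 'm. mm 0 = m \<and> (\<forall>i. mm i \<in> carrier (Md (ray_vertex s i))) \<and>
          (\<forall>i>0. (mm i, mm (i - 1)) \<in> mu_rel Md Om Mh s i))
      \<and> m \<notin> (\<Union>i. mu_le Md Om Mh s i {\<zero>\<^bsub>Md (ray_vertex s i)\<^esub>}))"
proof -
  let ?ker = "\<lambda>\<sigma>. hom_ker (Md \<sigma>) (Md (\<sigma> @ [True])) (Om \<sigma>)"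
  let ?im = "\<lambda>\<sigma>. hom_im (Md (\<sigma> @ [False])) (Mh \<sigma>)"
  have nc: "noetherian_cring R" by (intro noetherian_cring.intro assms)
  have lc: "linearly_compact R (Md \<sigma>) (carrier (Md \<sigma>))" for \<sigma>
    using fin_gen_module_linearly_compact[OF nc assms(3,4) Md_module[OF assms(5)] assms(6)] .
  \<comment> \<open>The vertex \<open>l\<close> is turned into a sequence by \<open>(!) l\<close>.
    Only positions below \<open>length l\<close> matter, so the unspecified values beyond are
    harmless.\<close>
  obtain s where "\<And>i. s i = (m \<notin> mu_le Md Om Mh ((!) (ray_vertex s i)) (length (ray_vertex s i)) (?ker (ray_vertex s i)))"
    using exists_ray_following[of "\<lambda>l. m \<notin> mu_le Md Om Mh ((!) l) (length l) (?ker l)"] by blast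
  moreover have "mu_le Md Om Mh ((!) (ray_vertex s i)) (length (ray_vertex s i)) S = mu_le Md Om Mh s i S" for i S
    by (simp add: ray_vertex_def) (rule mu_le_cong, simp)
  ultimately have s: "s i \<longleftrightarrow> m \<notin> mu_le Md Om Mh s i (?ker (ray_vertex s i))" for i by simp
  define c1 where "c1 \<longleftrightarrow> (\<exists>j. m \<in> mu_le Md Om Mh s j (?ker (ray_vertex s j)) \<and>
    m \<notin> mu_le Md Om Mh s j (?im (ray_vertex s j)))"
  define chain where "chain \<longleftrightarrow> (\<exists>mm. mm 0 = m \<and> (\<forall>i. mm i \<in> carrier (Md (ray_vertex s i))) \<and>
    (\<forall>i>0. (mm i, mm (i - 1)) \<in> mu_rel Md Om Mh s i))"
  define nonzero where "nonzero \<longleftrightarrow> m \<notin> (\<Union>i. mu_le Md Om Mh s i {\<zero>\<^bsub>Md (ray_vertex s i)\<^esub>})"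
  \<comment> \<open>At the index \<open>j\<close> witnessing \<open>c1\<close> the greedy rule takes
    the symbol \<open>False\<close>; a chain reaching level \<open>Suc j\<close> would then put
    \<open>m\<close> in relation with the image of \<mho>.\<close>
  have "\<not> chain" if "c1"
  proof
    assume chain
    then obtain mm where mm: "mm 0 = m" "\<forall>i. mm i \<in> carrier (Md (ray_vertex s i))"
        "\<forall>i>0. (mm i, mm (i - 1)) \<in> mu_rel Md Om Mh s i"
      unfolding chain_def by blast
    have "(mm (Suc i), mm i) \<in> mu_rel Md Om Mh s (Suc i)" for i
      using mm(3)[rule_format, of "Suc i"] by simp
    then have fin: "m \<in> mu_le Md Om Mh s n (carrier (Md (ray_vertex s n)))" for n
      unfolding mu_le_iff using mm(1,2) by (intro exI[of _ mm]) simp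
    obtain j where j: "m \<in> mu_le Md Om Mh s j (?ker (ray_vertex s j))"
      "m \<notin> mu_le Md Om Mh s j (?im (ray_vertex s j))" using \<open>c1\<close> unfolding c1_def by blast
    have "\<not> s j" using s[of j] j(1) by simp
    then show False using mu_le_Suc_False(1)[of R Md Om Mh s j] assms(5) fin[of "Suc j"] j(2) by simp
  qed
  moreover have "chain \<and> nonzero" if "\<not> c1"
  proof -
    \<comment> \<open>Both halves survive each step. After \<open>True\<close>, \<open>m\<close> is
      not related to the kernel, so it does not reach zero. After \<open>False\<close>,
      \<open>m\<close> is related to the kernel, hence to the image because \<open>c1\<close> fails,
      so the chain can be continued.\<close>
    have inv: "m \<in> mu_le Md Om Mh s n (carrier (Md (ray_vertex s n))) \<and>
        m \<notin> mu_le Md Om Mh s n {\<zero>\<^bsub>Md (ray_vertex s n)\<^esub>}" for n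
    proof (induction n)
      case 0
      show ?case using assms(8,9) by (auto simp: mu_le_iff ray_vertex_def)
    next
      case (Suc n)
      show ?case
      proof (cases "s n")
        case True
        then show ?thesis using mu_le_Suc_True[of R Md Om Mh s n] assms(5) True Suc s[of n] by simp
      next
        case False
        then have "m \<in> mu_le Md Om Mh s n (?im (ray_vertex s n))"
          using s[of n] \<open>\<not> c1\<close> unfolding c1_def by blast
        then show ?thesis using mu_le_Suc_False[of R Md Om Mh s n] assms(5) False Suc by auto
      qed
    qed
    have chain unfolding chain_def using exists_infinite_chain[OF assms(5) lc] inv by blast
    moreover have nonzero unfolding nonzero_def using inv by simp
    ultimately show ?thesis ..
  qed
  \<comment> \<open>Inequality of truth values expresses that exactly one alternative holds.\<close>
  ultimately have "c1 \<noteq> (chain \<and> nonzero)" by blast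
  then show ?thesis unfolding c1_def chain_def nonzero_def by (rule exI[of _ s])
qed

end
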